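(* Let $f_b=0$, $\alpha=0$, $n_e(\phi)=e^{-\phi}$, and $u_\infty>1$. Let $\varepsilon_0:=(u_\infty-1)/2$. There exist positive constants $\delta_0$ and $C_0$ such that if $0<\phi_b<\delta_0$, then $$\sup_{x\in\mathbb{R}_+}|\rho_\varepsilon(x)-\rho(x)|+\sup_{x\in\mathbb{R}_+}|\rho_\varepsilon u_\varepsilon(x)-\rho u(x)|+\sup_{x\in\mathbb{R}_+}|\phi_\varepsilon(x)-\phi(x)|\le C_0\varepsilon$$ for any $\varepsilon\in(0,\varepsilon_0)$ with $\varepsilon<1$. Here $(f_\varepsilon,\phi_\varepsilon)$ is the solution of the problem (VP) of the context with $f_\infty=f_{\infty,\varepsilon}$, $$\rho_\varepsilon(x):=\int_{\mathbb{R}^3}f_\varepsilon(x,\xi)\,d\xi,\qquad u_\varepsilon(x):=\frac{1}{\rho_\varepsilon(x)}\int_{\mathbb{R}^3}\xi_1f_\varepsilon(x,\xi)\,d\xi,$$ and $(\rho,u,\phi)$ is the unique monotone solution of the Euler--Poisson problem (EP) of the context.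
   Context: Notation: $\mathbb{R}_+=\{x>0\}$, $\overline{\mathbb{R}_+}=[0,\infty)$; $\xi=(\xi_1,\xi_2,\xi_3)=(\xi_1,\xi')\in\mathbb{R}^3$; $\mathbb{R}^3_+=\{\xi\in\mathbb{R}^3:\xi_1>0\}$. The problem (VP), with data $\alpha\in[0,1]$, $\phi_b\in\mathbb{R}$, nonnegative functions $f_b$ on $\mathbb{R}^3_+$ and $f_\infty$ on $\mathbb{R}^3$, and a given function $n_e$, is to find $f=f(x,\xi)$, $\phi=\phi(x)$ with $$\xi_1\partial_xf+\partial_x\phi\,\partial_{\xi_1}f=0,\qquad \partial_{xx}\phi=\int_{\mathbb{R}^3}f\,d\xi-n_e(\phi),\qquad x>0,\ \xi\in\mathbb{R}^3,$$ $$f(0,\xi)=f_b(\xi)+\alpha f(0,-\xi_1,\xi')\ (\xi_1>0),\quad \phi(0)=\phi_b,\quad \lim_{x\to\infty}f(x,\xi)=f_\infty(\xi),\quad \lim_{x\to\infty}\phi(x)=0.$$ $(f,\phi)$ is called a solution of (VP) if: (1) $f\in L^1_{loc}(\overline{\mathbb{R}_+}\times\mathbb{R}^3)\cap C(\overline{\mathbb{R}_+};L^1(\mathbb{R}^3))$ and $\phi\in C^1(\overline{\mathbb{R}_+})\cap C^2(\mathbb{R}_+)$; (2) $f\ge0$, and either $\partial_x\phi(x)>0$ for all $x\in\overline{\mathbb{R}_+}$ or $\partial_x\phi(x)<0$ for all $x\in\overline{\mathbb{R}_+}$; (3) $(f,\xi_1\partial_x\psi+\partial_x\phi\,\partial_{\xi_1}\psi)_{L^2(\mathbb{R}_+\times\mathbb{R}^3)}+(f_b,\xi_1\psi(0,\cdot))_{L^2(\mathbb{R}^3_+)}=0$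 for all $\psi\in\mathcal{X}$, where $\mathcal{X}=\{\psi\in C_0^1(\overline{\mathbb{R}_+}\times\mathbb{R}^3): \alpha\psi(0,\xi_1,\xi')=\psi(0,-\xi_1,\xi')\text{ for }(\xi_1,\xi')\in\mathbb{R}^3_+\}$ ($C^1$ functions with compact support in $\overline{\mathbb{R}_+}\times\mathbb{R}^3$), and $\lim_{x\to\infty}\|f(x,\cdot)-f_\infty\|_{L^1(\mathbb{R}^3)}=0$; (4) $\phi$ solves $\partial_{xx}\phi=\int_{\mathbb{R}^3}f\,d\xi-n_e(\phi)$ for $x>0$ with $\phi(0)=\phi_b$ and $\lim_{x\to\infty}\phi(x)=0$ in the classical sense. Approximate delta functions: fix $\varphi\in C_0^\infty(\mathbb{R}^3)$ with $\varphi\ge0$, $\operatorname{supp}\varphi\subset\{|\xi|<1\}$, $\int_{\mathbb{R}^3}\varphi\,d\xi=1$, and for $0<\varepsilon<1$ set $$f_{\infty,\varepsilon}(\xi):=\frac1{\varepsilon^3}\varphi\left(\frac{\xi-(-u_\infty,0,0)}{\varepsilon}\right).$$ For $\phi_b>0$ small (uniformly in $\varepsilon\in(0,\varepsilon_0)$), the problem (VP) with $f_b=\alpha=0$ and $f_\infty=f_{\infty,\varepsilon}$ has a unique solution, denoted $(f_\varepsilon,\phi_\varepsilon)$. The problem (EP): find $\rho=\rho(x)$, $u=u(x)$, $\phi=\phi(x)$ with $$(\rho u)'=0,\quad uu'=\phi',\quad \phi''=\rho-e^{-\phi},\quad x>0,$$ $$\inf_{x\in\mathbb{R}_+}\rho(x)>0,\quad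 \phi(0)=\phi_b,\quad \lim_{x\to\infty}(\rho,u,\phi)(x)=(1,-u_\infty,0).$$ For $u_\infty\ge1$ and $\phi_b>0$ it is known that (EP) has a unique monotone solution $(\rho,u,\phi)\in C^\infty(\overline{\mathbb{R}_+})$. *)

theory Defs
  imports "HOL-Analysis.Analysis"
begin

section \<open>Function spaces\<close>

abbreviation half_line :: "real set" where
  "half_line \<equiv> {0..}"

abbreviation phase_space :: "(real \<times> (real ^ 3)) set" where
  "phase_space \<equiv> half_line \<times> UNIV"

text \<open>On a closed half space the one-sided derivative is unique, so this is \<open>C\<^sup>1\<close> up to the boundary.\<close>

definition C1_on :: "'a::real_normed_vector set \<Rightarrow> ('a \<Rightarrow> 'b::real_normed_vector) \<Rightarrow> bool" where
  "C1_on S g \<longleftrightarrow>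
     (\<exists>g'. (\<forall>z\<in>S. (g has_derivative blinfun_apply (g' z)) (at z within S)) \<and> continuous_on S g')"

text \<open>\<open>C\<^sup>\<infinity>\<close> on the whole space: all iterated partial derivatives exist and are differentiable
  (hence continuous).\<close>

fun times_differentiable :: "nat \<Rightarrow> ('a::euclidean_space \<Rightarrow> real) \<Rightarrow> bool" where
  "times_differentiable 0 g \<longleftrightarrow> continuous_on UNIV g"
| "times_differentiable (Suc n) g \<longleftrightarrow> g differentiable_on UNIV \<and>
     (\<forall>b\<in>Basis. times_differentiable n (\<lambda>x. frechet_derivative g (at x) b))"

definition smooth :: "('a::euclidean_space \<Rightarrow> real) \<Rightarrow> bool" where
  "smooth g \<longleftrightarrow> (\<forall>n. times_differentiable n g)"

text \<open>\<open>C\<^sup>\<infinity>\<close> on the closed half line; \<open>D n\<close> is the \<open>n\<close>-th derivative, one-sided at 0.\<close>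

definition smooth_half_line :: "(real \<Rightarrow> real) \<Rightarrow> bool" where
  "smooth_half_line g \<longleftrightarrow>
     (\<exists>D. D 0 = g \<and> (\<forall>n. \<forall>x\<ge>0. (D n has_real_derivative D (Suc n) x) (at x within half_line)))"

section \<open>The Vlasov--Poisson problem (VP)\<close>

text \<open>Elements of the \<open>L\<^sup>1\<close> spaces are given by representatives. One and the same function
  \<open>f\<close> represents the locally integrable function on phase space and the \<open>L\<^sup>1\<close>-valued curve
  \<open>x \<mapsto> f x\<close>.\<close>

definition L1_loc :: "(real \<Rightarrow> real ^ 3 \<Rightarrow> real) \<Rightarrow> bool" where
  "L1_loc f \<longleftrightarrow>
     (\<forall>K. compact K \<and> K \<subseteq> phase_space \<longrightarrow> set_integrable lebesgue K (\<lambda>z. f (fst z) (snd z)))"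

definition C_L1 :: "(real \<Rightarrow> real ^ 3 \<Rightarrow> real) \<Rightarrow> bool" where
  "C_L1 f \<longleftrightarrow>
     (\<forall>x\<ge>0. integrable lebesgue (f x)) \<and>
     (\<forall>x\<ge>0. ((\<lambda>y. LINT \<xi>|lebesgue. \<bar>f y \<xi> - f x \<xi>\<bar>) \<longlongrightarrow> 0) (at x within half_line))"

definition reflect :: "real ^ 3 \<Rightarrow> real ^ 3" where
  "reflect \<xi> = vector [- \<xi> $ 1, \<xi> $ 2, \<xi> $ 3]"

text \<open>The test function space \<open>\<X>\<close>. Since \<open>phase_space\<close> is closed, the support taken here
  is the support relative to it, and it may meet the boundary \<open>x = 0\<close>.\<close>

definition VP_test :: "real \<Rightarrow> (real \<times> (real ^ 3) \<Rightarrow> real) \<Rightarrow> bool" where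
  "VP_test \<alpha> \<psi> \<longleftrightarrow>
     C1_on phase_space \<psi> \<and>
     compact (closure {z \<in> phase_space. \<psi> z \<noteq> 0}) \<and>
     (\<forall>\<xi>. \<xi> $ 1 > 0 \<longrightarrow> \<alpha> * \<psi> (0, \<xi>) = \<psi> (0, reflect \<xi>))"

text \<open>Used only at interior points \<open>x > 0\<close>.\<close>

definition d_x :: "(real \<times> (real ^ 3) \<Rightarrow> real) \<Rightarrow> real \<times> (real ^ 3) \<Rightarrow> real" where
  "d_x \<psi> z = frechet_derivative \<psi> (at z) (1, 0)"

definition d_xi1 :: "(real \<times> (real ^ 3) \<Rightarrow> real) \<Rightarrow> real \<times> (real ^ 3) \<Rightarrow> real" where
  "d_xi1 \<psi> z = frechet_derivative \<psi> (at z) (0, axis 1 1)"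

text \<open>\<open>p\<close> and \<open>q\<close> are the first and second derivatives of \<open>\<phi>\<close>. Integrability of \<open>f_inf\<close> is implied by
  the \<open>L\<^sup>1\<close> convergence; it is listed because the Bochner integral of a
  non-integrable function is 0.\<close>

definition VP_solution ::
  "real \<Rightarrow> real \<Rightarrow> (real ^ 3 \<Rightarrow> real) \<Rightarrow> (real ^ 3 \<Rightarrow> real) \<Rightarrow> (real \<Rightarrow> real) \<Rightarrow>
   (real \<Rightarrow> real ^ 3 \<Rightarrow> real) \<Rightarrow> (real \<Rightarrow> real) \<Rightarrow> bool" where
  "VP_solution \<alpha> \<phi>\<^sub>b f\<^sub>b f_inf n\<^sub>e f \<phi> \<longleftrightarrow> (\<exists>p q.
     L1_loc f \<and> C_L1 f \<and>
     (\<forall>x\<ge>0. (\<phi> has_real_derivative p x) (at x within half_line)) \<and> continuous_on half_line p \<and>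
     (\<forall>x>0. (p has_real_derivative q x) (at x)) \<and> continuous_on {0<..} q \<and>
     (\<forall>x\<ge>0. AE \<xi> in lebesgue. f x \<xi> \<ge> 0) \<and>
     ((\<forall>x\<ge>0. p x > 0) \<or> (\<forall>x\<ge>0. p x < 0)) \<and>
     (\<forall>\<psi>. VP_test \<alpha> \<psi> \<longrightarrow>
        (LINT z:({0<..} \<times> UNIV)|lebesgue.
           f (fst z) (snd z) * (snd z $ 1 * d_x \<psi> z + p (fst z) * d_xi1 \<psi> z)) +
        (LINT \<xi>:{\<xi>. \<xi> $ 1 > 0}|lebesgue. f\<^sub>b \<xi> * (\<xi> $ 1 * \<psi> (0, \<xi>))) = 0) \<and>
     integrable lebesgue f_inf \<and>
     ((\<lambda>x. LINT \<xi>|lebesgue. \<bar>f x \<xi> - f_inf \<xi>\<bar>) \<longlongrightarrow> 0) at_top \<and>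
     (\<forall>x>0. q x = (LINT \<xi>|lebesgue. f x \<xi>) - n\<^sub>e (\<phi> x)) \<and>
     \<phi> 0 = \<phi>\<^sub>b \<and>
     (\<phi> \<longlongrightarrow> 0) at_top)"

definition particle_density :: "(real \<Rightarrow> real ^ 3 \<Rightarrow> real) \<Rightarrow> real \<Rightarrow> real" where
  "particle_density f x = (LINT \<xi>|lebesgue. f x \<xi>)"

definition mean_velocity :: "(real \<Rightarrow> real ^ 3 \<Rightarrow> real) \<Rightarrow> real \<Rightarrow> real" where
  "mean_velocity f x = 1 / particle_density f x * (LINT \<xi>|lebesgue. \<xi> $ 1 * f x \<xi>)"

section \<open>Approximate delta functions\<close>

definition mollifier :: "(real ^ 3 \<Rightarrow> real) \<Rightarrow> bool" where
  "mollifier \<eta> \<longleftrightarrow>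
     smooth \<eta> \<and> (\<forall>\<xi>. \<eta> \<xi> \<ge> 0) \<and>
     closure {\<xi>. \<eta> \<xi> \<noteq> 0} \<subseteq> ball 0 1 \<and>
     (LINT \<xi>|lebesgue. \<eta> \<xi>) = 1"

definition approx_delta :: "(real ^ 3 \<Rightarrow> real) \<Rightarrow> real \<Rightarrow> real \<Rightarrow> real ^ 3 \<Rightarrow> real" where
  "approx_delta \<eta> u_inf \<epsilon> \<xi> = 1 / \<epsilon> ^ 3 * \<eta> ((\<xi> - vector [- u_inf, 0, 0]) /\<^sub>R \<epsilon>)"

section \<open>The Euler--Poisson problem (EP)\<close>

definition monotone_half_line :: "(real \<Rightarrow> real) \<Rightarrow> bool" where
  "monotone_half_line g \<longleftrightarrow> mono_on half_line g \<or> antimono_on half_line g"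

text \<open>A monotone solution is one all of whose components are monotone. The infimum is taken in the
  extended reals, where it is meaningful without a boundedness assumption.\<close>

definition EP_monotone_solution ::
  "real \<Rightarrow> real \<Rightarrow> (real \<Rightarrow> real) \<Rightarrow> (real \<Rightarrow> real) \<Rightarrow> (real \<Rightarrow> real) \<Rightarrow> bool" where
  "EP_monotone_solution u_inf \<phi>\<^sub>b \<rho> u \<phi> \<longleftrightarrow>
     smooth_half_line \<rho> \<and> smooth_half_line u \<and> smooth_half_line \<phi> \<and>
     monotone_half_line \<rho> \<and> monotone_half_line u \<and> monotone_half_line \<phi> \<and>
     (\<forall>x>0. deriv (\<lambda>y. \<rho> y * u y) x = 0 \<and>
            u x * deriv u x = deriv \<phi> x \<and>
            deriv (deriv \<phi>) x = \<rho> x - exp (- \<phi> x)) \<and>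
     (INF x\<in>{0<..}. ereal (\<rho> x)) > 0 \<and>
     \<phi> 0 = \<phi>\<^sub>b \<and>
     ((\<lambda>x. (\<rho> x, u x, \<phi> x)) \<longlongrightarrow> (1, - u_inf, 0)) at_top"

text \<open>Suprema over \<open>x > 0\<close> are taken in the extended reals, so that an upper bound
  on them includes boundedness.\<close>

definition sup_dist :: "(real \<Rightarrow> real) \<Rightarrow> (real \<Rightarrow> real) \<Rightarrow> ereal" where
  "sup_dist g h = (SUP x\<in>{0<..}. ereal \<bar>g x - h x\<bar>)"

end

theory Submission
  imports Defs
begin

text \<open>
  With \<open>\<alpha> = 0\<close> and \<open>f\<^sub>b = 0\<close> no particle leaves the wall, so the kinetic problem reduces to an
  ordinary differential equation for the potential that is \<open>O(\<epsilon>)\<close>-close to the Euler--Poisson one.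

  \<^bold>\<open>The kinetic part.\<close> Since \<open>\<phi> 0 > 0\<close> and \<open>\<phi>\<close> tends to 0, the potential is decreasing. The transport
  operator \<open>\<xi>\<^sub>1 \<partial>\<^sub>x + \<phi>' \<partial>\<^sub>\<xi>\<^sub>1\<close> annihilates every function of the energy \<open>E = \<xi>\<^sub>1\<^sup>2 / 2 - \<phi> x\<close> and of \<open>\<xi>'\<close>, so
  testing the weak equation with products \<open>\<zeta>(x) a(\<xi>\<^sub>1) k(E) b(\<xi>\<^sub>2) b(\<xi>\<^sub>3)\<close> leaves identities in which
  only \<open>\<zeta>'\<close> and \<open>a'\<close> appear (\<open>product_test\<close>). Three choices determine the moments of \<open>f\<close>.
  For \<open>E < 0\<close> the characteristics start and end at the wall; taking first \<open>a\<close> and then \<open>\<zeta>\<close> monotone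
  gives an integrand of one sign, so \<open>f\<close> vanishes there (\<open>trapped_vanish\<close>).
  For \<open>E > 0\<close> the sign of \<open>\<xi>\<^sub>1\<close> is constant along characteristics and the flux
  \<open>\<integral> \<xi>\<^sub>1 k(E) b b f d\<xi>\<close> carried by each sign is independent of \<open>x\<close>, hence equal to its value at infinity
  (\<open>conserved_pairing\<close>); removing the cut-offs by monotone convergence gives \<open>weighted_pairing\<close>.
  The weight 1 shows that \<open>f = 0\<close> where \<open>\<xi>\<^sub>1 > 0\<close> and that the total flux is that of \<open>f_inf\<close>;
  the weight \<open>1 / sqrt (2 E + 2 \<phi> x)\<close>, which is \<open>1 / \<bar>\<xi>\<^sub>1\<bar>\<close> at the point \<open>x\<close>, gives
  \<open>\<rho>\<^sub>\<epsilon> x = \<integral> f_inf \<bar>\<xi>\<^sub>1\<bar> / sqrt (\<xi>\<^sub>1\<^sup>2 + 2 \<phi> x) d\<xi>\<close> (\<open>density_formula\<close>).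

  \<^bold>\<open>The comparison.\<close> Mass and energy conservation turn the Euler--Poisson problem into
  \<open>\<phi>'' = N \<phi> - exp (- \<phi>)\<close> with \<open>N s = u_inf / sqrt (u_inf\<^sup>2 + 2 s)\<close>, the density of a monokinetic beam. As
  \<open>f_inf\<close> lives within \<open>\<epsilon>\<close> of the velocity of that beam, the kinetic density differs from
  \<open>N (\<phi>\<^sub>\<epsilon> x)\<close> by at most \<open>2 \<epsilon> \<phi>\<^sub>\<epsilon> x\<close>. The supersonic condition \<open>u_inf > 1\<close> makes \<open>N s - exp (- s)\<close> strictly
  increasing for small \<open>s\<close> (\<open>charge_increasing\<close>), so at a positive maximum of
  \<open>\<phi>\<^sub>\<epsilon> - \<phi>\<close> or \<open>\<phi> - \<phi>\<^sub>\<epsilon>\<close> exceeding \<open>2 \<epsilon>\<close> the second derivative would be positive. Hence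
  \<open>\<bar>\<phi>\<^sub>\<epsilon> - \<phi>\<bar> \<le> 2 \<epsilon>\<close>, and the estimates of density and flux follow.
\<close>

section \<open>Explicit cut-off functions of class C1\<close>

definition pos_sq :: "real \<Rightarrow> real" where
  "pos_sq t = (max 0 t)\<^sup>2"

lemma has_derivative_pos_sq: "(pos_sq has_real_derivative 2 * max 0 t) (at t)"
proof -
  consider "t > 0" | "t < 0" | "t = 0" by linarith
  then show ?thesis
  proof cases
    case 1
    have "((\<lambda>t. t\<^sup>2) has_real_derivative 2 * max 0 t) (at t)"
      using 1 by (auto intro!: derivative_eq_intros)
    then show ?thesis
      by (rule has_field_derivative_transform_within_open[of _ _ _ "{0<..}"])
        (use 1 in \<open>auto simp: pos_sq_def\<close>)
  next
    case 2
    have "((\<lambda>t. 0) has_real_derivative 2 * max 0 t) (at t)"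
      using 2 by (auto intro!: derivative_eq_intros)
    then show ?thesis
      by (rule has_field_derivative_transform_within_open[of _ _ _ "{..<0}"])
        (use 2 in \<open>auto simp: pos_sq_def\<close>)
  next
    case 3
    have "((\<lambda>h. max 0 h * max 0 h / h) \<longlongrightarrow> 0) (at (0::real))"
    proof (rule tendsto_sandwich[of "\<lambda>h. 0" _ _ "\<lambda>h. \<bar>h\<bar>"])
      show "\<forall>\<^sub>F h::real in at 0. 0 \<le> max 0 h * max 0 h / h"
        by (auto intro!: always_eventually simp: max_def)
      show "\<forall>\<^sub>F h::real in at 0. max 0 h * max 0 h / h \<le> \<bar>h\<bar>"
        by (auto intro!: always_eventually simp: max_def)
    qed (auto intro!: tendsto_eq_intros)
    then show ?thesis
      using 3 by (simp add: has_field_derivative_iff pos_sq_def power2_eq_square)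
  qed
qed

lemmas has_derivative_pos_sq' [derivative_intros] = DERIV_chain2[OF has_derivative_pos_sq]

lemma continuous_on_pos_sq [continuous_intros]:
  "continuous_on S f \<Longrightarrow> continuous_on S (\<lambda>x. pos_sq (f x))"
  unfolding pos_sq_def by (intro continuous_intros)

lemma pos_sq_nonneg: "pos_sq t \<ge> 0" and pos_sq_eq_0_iff: "pos_sq t = 0 \<longleftrightarrow> t \<le> 0"
  and pos_sq_pos_iff: "pos_sq t > 0 \<longleftrightarrow> t > 0"
  by (auto simp: pos_sq_def max_def)

lemma pos_sq_mono: "s \<le> t \<Longrightarrow> pos_sq s \<le> pos_sq t"
  by (auto simp: pos_sq_def intro!: power_mono)

text \<open>The scaled second difference of \<open>max 0\<close>: a hat of mass 1 supported in \<open>[- r, r]\<close>. Its antiderivative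
  \<open>smooth_step\<close>, that of \<open>pos_sq\<close>, is a \<open>C\<^sup>1\<close> step from 0 to 1.\<close>
definition tent :: "real \<Rightarrow> real \<Rightarrow> real" where
  "tent r t = (max 0 (t + r) - 2 * max 0 t + max 0 (t - r)) / r\<^sup>2"

definition smooth_step :: "real \<Rightarrow> real \<Rightarrow> real" where
  "smooth_step r t = (pos_sq (t + r) - 2 * pos_sq t + pos_sq (t - r)) / (2 * r\<^sup>2)"

lemma has_derivative_smooth_step:
  assumes "r > 0"
  shows "(smooth_step r has_real_derivative tent r t) (at t)"
  unfolding smooth_step_def[abs_def] tent_def
  by (rule derivative_eq_intros refl | use assms in \<open>simp add: field_simps\<close>)+

lemma continuous_on_tent [continuous_intros]:
  "continuous_on S f \<Longrightarrow> continuous_on S (\<lambda>x. tent r (f x))"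
  unfolding tent_def divide_inverse by (intro continuous_intros)

lemma tent_nonneg: "r > 0 \<Longrightarrow> tent r t \<ge> 0"
  by (auto simp: tent_def max_def)

lemma tent_eq_0: "r > 0 \<Longrightarrow> \<bar>t\<bar> \<ge> r \<Longrightarrow> tent r t = 0"
  by (auto simp: tent_def max_def)

lemma smooth_step_eq_0: "r > 0 \<Longrightarrow> t \<le> - r \<Longrightarrow> smooth_step r t = 0"
  by (auto simp: smooth_step_def pos_sq_def max_def)

lemma smooth_step_eq_1: "r > 0 \<Longrightarrow> t \<ge> r \<Longrightarrow> smooth_step r t = 1"
  by (auto simp: smooth_step_def pos_sq_def max_def field_simps power2_eq_square)

lemma has_integral_tent:
  assumes "r > 0"
  shows "((\<lambda>x. tent r (x - y)) has_integral 1) {y - r..y + r}"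
proof -
  have "((\<lambda>x. tent r (x - y)) has_integral smooth_step r (y + r - y) - smooth_step r (y - r - y))
      {y - r..y + r}"
  proof (rule fundamental_theorem_of_calculus)
    fix x
    have "((\<lambda>a. smooth_step r (a - y)) has_real_derivative tent r (x - y) * 1) (at x)"
      by (rule DERIV_chain2[OF has_derivative_smooth_step[OF assms]])
        (auto intro!: derivative_eq_intros)
    then show "((\<lambda>a. smooth_step r (a - y)) has_vector_derivative tent r (x - y))
        (at x within {y - r..y + r})"
      by (simp add: has_real_derivative_iff_has_vector_derivative has_vector_derivative_at_within)
  qed (use assms in auto)
  then show ?thesis
    using assms by (simp add: smooth_step_eq_0 smooth_step_eq_1)
qed

section \<open>Integration lemmas\<close>

text \<open>Strong \<open>L\<^sup>1\<close> convergence of \<open>g n\<close> paired with bounded pointwise convergence of \<open>m n\<close>: replacing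
  \<open>g n\<close> by its limit costs at most \<open>B\<close> times the \<open>L\<^sup>1\<close> distance, and dominated convergence does the rest.\<close>
lemma integral_pairing_tendsto:
  fixes g :: "nat \<Rightarrow> 'a \<Rightarrow> real" and m :: "nat \<Rightarrow> 'a \<Rightarrow> real"
  assumes g: "\<And>n. integrable M (g n)" and g0: "integrable M g0"
    and lim_g: "(\<lambda>n. LINT z|M. \<bar>g n z - g0 z\<bar>) \<longlonglongrightarrow> 0"
    and m: "\<And>n. m n \<in> borel_measurable M" and m0: "m0 \<in> borel_measurable M"
    and bound: "\<And>n z. \<bar>m n z\<bar> \<le> B"
    and lim_m: "\<And>z. (\<lambda>n. m n z) \<longlonglongrightarrow> m0 z"
  shows "(\<lambda>n. LINT z|M. g n z * m n z) \<longlonglongrightarrow> (LINT z|M. g0 z * m0 z)"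
proof -
  have int_gm: "integrable M (\<lambda>z. h z * m n z)" if "integrable M h" for h n
    by (rule Bochner_Integration.integrable_bound[of _ "\<lambda>z. B * h z"])
      (use that m bound in \<open>auto simp: abs_mult mult.commute[of B] intro!: mult_left_mono order_trans[OF bound abs_ge_self]\<close>)
  have "(\<lambda>n. LINT z|M. g0 z * m n z) \<longlonglongrightarrow> (LINT z|M. g0 z * m0 z)"
  proof (rule integral_dominated_convergence[where w = "\<lambda>z. B * \<bar>g0 z\<bar>"])
    show "AE z in M. norm (g0 z * m n z) \<le> B * \<bar>g0 z\<bar>" for n
      using bound by (auto simp: abs_mult mult.commute[of B] intro!: mult_left_mono)
    show "AE z in M. (\<lambda>n. g0 z * m n z) \<longlonglongrightarrow> g0 z * m0 z"
      using lim_m by (auto intro!: tendsto_intros)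
  qed (use g0 m m0 in auto)
  moreover have "(\<lambda>n. LINT z|M. (g n z - g0 z) * m n z) \<longlonglongrightarrow> 0"
  proof (rule Lim_null_comparison)
    have "\<bar>LINT z|M. (g n z - g0 z) * m n z\<bar> \<le> (LINT z|M. \<bar>g n z - g0 z\<bar>) * B" for n
    proof -
      have "\<bar>LINT z|M. (g n z - g0 z) * m n z\<bar> \<le> (LINT z|M. \<bar>(g n z - g0 z) * m n z\<bar>)"
        by (rule integral_abs_bound)
      also have "\<dots> \<le> (LINT z|M. \<bar>g n z - g0 z\<bar> * B)"
        using g g0 bound
        by (intro integral_mono integrable_abs int_gm) (auto simp: abs_mult intro!: mult_left_mono)
      finally show ?thesis by simp
    qed
    then show "\<forall>\<^sub>F n in sequentially.
        norm (LINT z|M. (g n z - g0 z) * m n z) \<le> (LINT z|M. \<bar>g n z - g0 z\<bar>) * B"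
      by simp
    show "(\<lambda>n. (LINT z|M. \<bar>g n z - g0 z\<bar>) * B) \<longlonglongrightarrow> 0"
      using tendsto_mult_right[OF lim_g, of B] by simp
  qed
  ultimately have "(\<lambda>n. (LINT z|M. g0 z * m n z) + (LINT z|M. (g n z - g0 z) * m n z))
      \<longlonglongrightarrow> (LINT z|M. g0 z * m0 z) + 0"
    by (rule tendsto_add)
  moreover have "(LINT z|M. g0 z * m n z) + (LINT z|M. (g n z - g0 z) * m n z)
      = (LINT z|M. g n z * m n z)" for n
    by (subst Bochner_Integration.integral_add[symmetric])
      (auto intro!: int_gm g g0 simp: algebra_simps)
  ultimately show ?thesis by simp
qed

lemma borel_measurable_lebesgue_cong_AE:
  fixes g h :: "'a::euclidean_space \<Rightarrow> real"
  assumes g: "g \<in> borel_measurable lebesgue" and eq: "AE x in lebesgue. h x = g x"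
  shows "h \<in> borel_measurable lebesgue"
proof (rule measurableI)
  fix A :: "real set" assume "A \<in> sets borel"
  then have "g -` A \<in> sets lebesgue"
    using measurable_sets[OF g] by simp
  then show "h -` A \<inter> space lebesgue \<in> sets lebesgue"
    by (rule completion.in_sets_AE[rotated]) (use eq in auto)
qed auto

text \<open>The completed measure on a product is not the product of the completed measures. A Borel
  representative of \<open>F\<close> reduces the claim to Fubini for \<open>lborel\<close>; almost every slice of \<open>F\<close> agrees almost everywhere with
  that of the representative.\<close>
lemma lebesgue_Fubini:
  fixes F :: "'a::euclidean_space \<times> 'b::euclidean_space \<Rightarrow> real"
  assumes F: "integrable lebesgue F"
    and slice: "\<And>x. (\<lambda>y. F (x, y)) \<in> borel_measurable lebesgue"
  shows "integrable lebesgue (\<lambda>x. LINT y|lebesgue. F (x, y))"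
    and "(LINT x|lebesgue. LINT y|lebesgue. F (x, y)) = integral\<^sup>L lebesgue F"
proof -
  obtain G where G: "G \<in> borel_measurable lborel" and FG: "AE z in lborel. F z = G z"
    using completion_ex_borel_measurable_real[of F lborel] F by auto
  have FG': "AE z in lebesgue. F z = G z"
    using FG by (rule AE_completion)
  have G': "integrable lborel G"
    using F integrable_cong_AE[OF borel_measurable_integrable[OF F] measurable_completion[OF G] FG']
      integrable_completion[of G lborel] G by simp
  then have Gp: "integrable (lborel \<Otimes>\<^sub>M lborel) (\<lambda>z. G z)"
    by (simp add: lborel_prod)
  have "AE z in lborel \<Otimes>\<^sub>M lborel. F z = G z"
    using FG by (simp only: lborel_prod)
  then have "AE x in lborel. AE y in lborel. F (x, y) = G (x, y)"
    by (rule lborel_pair.AE_pair)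
  then have eq: "AE x in lborel. (LINT y|lebesgue. F (x, y)) = (LINT y|lborel. G (x, y))"
  proof (rule AE_mp, intro AE_I2 impI)
    fix x assume *: "AE y in lborel. F (x, y) = G (x, y)"
    have Gx: "(\<lambda>y. G (x, y)) \<in> borel_measurable lborel"
      using G by measurable
    have "(LINT y|lebesgue. F (x, y)) = (LINT y|lebesgue. G (x, y))"
      by (rule integral_cong_AE[OF slice measurable_completion[OF Gx] AE_completion[OF *]])
    also have "\<dots> = (LINT y|lborel. G (x, y))"
      by (rule integral_completion[OF Gx])
    finally show "(LINT y|lebesgue. F (x, y)) = (LINT y|lborel. G (x, y))" .
  qed
  have int: "integrable lborel (\<lambda>x. LINT y|lborel. G (x, y))"
    by (rule lborel_pair.integrable_fst'[OF Gp])
  then have meas: "(\<lambda>x. LINT y|lborel. G (x, y)) \<in> borel_measurable lborel"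
    by auto
  have meas': "(\<lambda>x. LINT y|lebesgue. F (x, y)) \<in> borel_measurable lebesgue"
    by (rule borel_measurable_lebesgue_cong_AE[OF _ AE_completion])
      (use measurable_completion[OF meas] eq in auto)
  show "integrable lebesgue (\<lambda>x. LINT y|lebesgue. F (x, y))"
    using int integrable_completion[OF meas] 
      integrable_cong_AE[OF meas' measurable_completion[OF meas] AE_completion[OF eq]] by simp
  have "(LINT x|lebesgue. LINT y|lebesgue. F (x, y)) = (LINT x|lebesgue. LINT y|lborel. G (x, y))"
    by (rule integral_cong_AE[OF meas' measurable_completion[OF meas] AE_completion[OF eq]])
  also have "\<dots> = (LINT x|lborel. LINT y|lborel. G (x, y))"
    by (rule integral_completion[OF meas])
  also have "\<dots> = integral\<^sup>L lborel G"
    using lborel_pair.integral_fst'[OF Gp] by (simp add: lborel_prod)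
  also have "\<dots> = integral\<^sup>L lebesgue G"
    by (rule integral_completion[OF G, symmetric])
  also have "\<dots> = integral\<^sup>L lebesgue F"
    by (rule integral_cong_AE[OF borel_measurable_integrable[OF F] measurable_completion[OF G] FG',
          symmetric])
  finally show "(LINT x|lebesgue. LINT y|lebesgue. F (x, y)) = integral\<^sup>L lebesgue F" .
qed

lemma nonneg_continuous_integral_0_imp_0:
  fixes G :: "real \<Rightarrow> real"
  assumes S: "open S" and G: "continuous_on S G" and nonneg: "\<And>x. x \<in> S \<Longrightarrow> 0 \<le> G x"
    and int: "set_integrable lebesgue S G" and zero: "(LINT x:S|lebesgue. G x) = 0"
    and x: "x \<in> S"
  shows "G x = 0"
proof -
  have "AE x in lebesgue. indicat_real S x * G x = 0"
    using int zero nonneg integral_nonneg_eq_0_iff_AE[of lebesgue "\<lambda>x. indicat_real S x * G x"]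
    by (auto simp: set_integrable_def set_lebesgue_integral_def indicator_def)
  then have "negligible {x. indicat_real S x * G x \<noteq> 0}"
    by (simp add: negligible_iff_null_sets completion.AE_iff_null_sets)
  moreover have "{x. indicat_real S x * G x \<noteq> 0} = {x \<in> S. G x \<in> - {0}}"
    by (auto simp: indicator_def)
  moreover have "open {x \<in> S. G x \<in> - {0}}"
    using continuous_open_preimage[OF G S, of "- {0}"] by (simp add: vimage_def Int_def open_Compl)
  ultimately have "{x \<in> S. G x \<in> - {0}} = {}"
    using open_not_negligible by metis
  then show ?thesis
    using x by auto
qed

text \<open>A form of the du Bois-Reymond lemma: \<open>tent r (x - x1) - tent r (x - x2)\<close> is the derivative of a
  compactly supported function, and as \<open>r\<close> tends to 0 the two averages tend to \<open>g x1\<close> and \<open>g x2\<close>.\<close>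
lemma const_if_tent_averages_agree:
  fixes g :: "real \<Rightarrow> real"
  assumes g: "continuous_on {0<..} g"
    and avg: "\<And>r. 0 < r \<Longrightarrow> r < x1 \<Longrightarrow> r < x2 \<Longrightarrow>
      (LINT x:{0<..}|lebesgue. (tent r (x - x1) - tent r (x - x2)) * g x) = 0"
    and pos: "x1 > 0" "x2 > 0"
  shows "g x1 = g x2"
proof -
  have supp: "(\<lambda>x. indicat_real {0<..} x * (tent r (x - y) * g x))
      = (\<lambda>x. indicat_real {y - r..y + r} x * (tent r (x - y) * g x))" if "0 < r" "r < y" for r y
    using that by (auto simp: fun_eq_iff indicator_def tent_eq_0)
  have cont: "continuous_on {y - r..y + r} (\<lambda>x. tent r (x - y) * g x)" if "0 < r" "r < y" for r y
    by (intro continuous_intros continuous_on_subset[OF g]) (use that in auto)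
  have int: "set_integrable lebesgue {0<..} (\<lambda>x. tent r (x - y) * g x)"
    and eq: "(LINT x:{0<..}|lebesgue. tent r (x - y) * g x)
      = integral {y - r..y + r} (\<lambda>x. tent r (x - y) * g x)" if "0 < r" "r < y" for r y
    using absolutely_integrable_continuous_real[OF cont[OF that]] supp[OF that]
      set_lebesgue_integral_eq_integral(2)[OF absolutely_integrable_continuous_real[OF cont[OF that]]]
    by (simp_all add: set_integrable_def set_lebesgue_integral_def)
  have near: "\<bar>integral {y - r..y + r} (\<lambda>x. tent r (x - y) * g x) - g y\<bar> \<le> \<eta>"
    if r: "0 < r" "r < y" and close: "\<And>x. \<bar>x - y\<bar> \<le> r \<Longrightarrow> \<bar>g x - g y\<bar> \<le> \<eta>" for r y \<eta>
  proof -
    have I: "((\<lambda>x. tent r (x - y) * g x) has_integral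
        integral {y - r..y + r} (\<lambda>x. tent r (x - y) * g x)) {y - r..y + r}"
      using integrable_continuous_real[OF cont[OF r]] by (simp add: has_integral_integral)
    have C: "((\<lambda>x. tent r (x - y) * c) has_integral c) {y - r..y + r}" for c
      using has_integral_mult_left[OF has_integral_tent[OF r(1), of y], of c] by simp
    have close': "g x \<le> g y + \<eta>" "g y - \<eta> \<le> g x" if "x \<in> {y - r..y + r}" for x
      using close[of x] that by (auto simp: abs_le_iff)
    have "integral {y - r..y + r} (\<lambda>x. tent r (x - y) * g x) \<le> g y + \<eta>"
      by (rule has_integral_le[OF I C]) (use close' tent_nonneg r in \<open>auto intro!: mult_left_mono\<close>)
    moreover have "g y - \<eta> \<le> integral {y - r..y + r} (\<lambda>x. tent r (x - y) * g x)"
      by (rule has_integral_le[OF C I]) (use close' tent_nonneg r in \<open>auto intro!: mult_left_mono\<close>)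
    ultimately show ?thesis by linarith
  qed
  have "\<bar>g x1 - g x2\<bar> \<le> 0 + e" if "e > 0" for e
  proof -
    have ex: "\<exists>d>0. \<forall>x. \<bar>x - y\<bar> < d \<longrightarrow> \<bar>g x - g y\<bar> < e / 2" if "y > 0" for y
    proof -
      have "isCont g y"
        using g that by (simp add: continuous_on_eq_continuous_at)
      then show ?thesis
        using \<open>e > 0\<close> unfolding continuous_at_eps_delta dist_real_def by (meson half_gt_zero)
    qed
    obtain d1 d2 where d: "d1 > 0" "\<And>x. \<bar>x - x1\<bar> < d1 \<Longrightarrow> \<bar>g x - g x1\<bar> < e / 2"
      "d2 > 0" "\<And>x. \<bar>x - x2\<bar> < d2 \<Longrightarrow> \<bar>g x - g x2\<bar> < e / 2"
      using ex[OF pos(1)] ex[OF pos(2)] by metis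
    define r where "r = min (min d1 d2) (min x1 x2) / 2"
    have r: "0 < r" "r < x1" "r < x2" "r < d1" "r < d2"
      using d pos by (auto simp: r_def min_def)
    have "integral {x1 - r..x1 + r} (\<lambda>x. tent r (x - x1) * g x)
        - integral {x2 - r..x2 + r} (\<lambda>x. tent r (x - x2) * g x) = 0"
      using avg[OF r(1-3)] set_integral_diff(2)[OF int[OF r(1,2)] int[OF r(1,3)]]
        eq[OF r(1,2)] eq[OF r(1,3)] by (simp add: left_diff_distrib)
    moreover have "\<bar>integral {x1 - r..x1 + r} (\<lambda>x. tent r (x - x1) * g x) - g x1\<bar> \<le> e / 2"
      by (rule near[OF r(1,2)], rule less_imp_le, rule d(2)) (use r in auto)
    moreover have "\<bar>integral {x2 - r..x2 + r} (\<lambda>x. tent r (x - x2) * g x) - g x2\<bar> \<le> e / 2"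
      by (rule near[OF r(1,3)], rule less_imp_le, rule d(4)) (use r in auto)
    ultimately show ?thesis by linarith
  qed
  then have "\<bar>g x1 - g x2\<bar> \<le> 0"
    by (rule field_le_epsilon)
  then show ?thesis by simp
qed

section \<open>The weak Vlasov equation tested with functions of the energy\<close>

lemma C1_UNIV_D:
  fixes g :: "real \<Rightarrow> real"
  assumes "g C1_differentiable_on UNIV"
  obtains g' where "\<And>t. (g has_real_derivative g' t) (at t)" "continuous_on UNIV g'"
    "continuous_on UNIV g"
  using assms unfolding C1_differentiable_on_def has_real_derivative_iff_has_vector_derivative[symmetric]
  by (metis DERIV_continuous continuous_at_imp_continuous_on UNIV_I)

lemma C1_UNIV_I:
  fixes g :: "real \<Rightarrow> real"
  assumes "\<And>t. (g has_real_derivative g' t) (at t)" "continuous_on UNIV g'"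
  shows "g C1_differentiable_on UNIV"
  using assms unfolding C1_differentiable_on_def has_real_derivative_iff_has_vector_derivative[symmetric]
  by blast

text \<open>The kinetic half of the problem for an absorbing wall (\<open>\<alpha> = 0\<close>, \<open>f\<^sub>b = 0\<close>) and a given decreasing potential
  \<open>\<phi>\<close> with derivative \<open>p\<close>. The results below express \<open>f\<close> and its moments through \<open>\<phi>\<close> and
  \<open>f_inf\<close>.\<close>
locale vlasov_sheath =
  fixes f :: "real \<Rightarrow> real ^ 3 \<Rightarrow> real" and \<phi> p :: "real \<Rightarrow> real" and f_inf :: "real ^ 3 \<Rightarrow> real"
  assumes loc: "L1_loc f" and curve: "C_L1 f"
    and phi_deriv: "\<And>x. x \<ge> 0 \<Longrightarrow> (\<phi> has_real_derivative p x) (at x within half_line)"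
    and p_cont: "continuous_on half_line p"
    and p_neg: "\<And>x. x \<ge> 0 \<Longrightarrow> p x < 0"
    and f_nonneg: "\<And>x. x \<ge> 0 \<Longrightarrow> AE \<xi> in lebesgue. f x \<xi> \<ge> 0"
    and weak: "\<And>\<psi>. VP_test 0 \<psi> \<Longrightarrow>
        (LINT z:({0<..} \<times> UNIV)|lebesgue.
           f (fst z) (snd z) * (snd z $ 1 * d_x \<psi> z + p (fst z) * d_xi1 \<psi> z)) = 0"
    and f_inf_int: "integrable lebesgue f_inf"
    and f_lim: "((\<lambda>x. LINT \<xi>|lebesgue. \<bar>f x \<xi> - f_inf \<xi>\<bar>) \<longlongrightarrow> 0) at_top"
    and phi_lim: "(\<phi> \<longlongrightarrow> 0) at_top"
begin

lemma f_int: "x \<ge> 0 \<Longrightarrow> integrable lebesgue (f x)"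
  using curve by (simp add: C_L1_def)

lemma phi_cont: "continuous_on half_line \<phi>"
  by (rule DERIV_continuous_on) (use phi_deriv in auto)

lemma phi_strict_antimono:
  assumes "0 \<le> x" "x < y"
  shows "\<phi> y < \<phi> x"
proof (rule DERIV_neg_imp_decreasing_open[OF \<open>x < y\<close>])
  show "continuous_on {x..y} \<phi>"
    by (rule continuous_on_subset[OF phi_cont]) (use assms in auto)
  fix t assume "x < t" "t < y"
  then have "(\<phi> has_real_derivative p t) (at t)"
    using phi_deriv[of t] assms by (simp add: at_within_interior[of t half_line])
  then show "\<exists>D. (\<phi> has_real_derivative D) (at t) \<and> D < 0"
    using p_neg[of t] \<open>x < t\<close> assms by auto
qed

lemma phi_antimono: "0 \<le> x \<Longrightarrow> x \<le> y \<Longrightarrow> \<phi> y \<le> \<phi> x"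
  using phi_strict_antimono[of x y] by (cases "x = y") auto

lemma phi_pos:
  assumes "x \<ge> 0"
  shows "\<phi> x > 0"
proof -
  have "0 \<le> \<phi> (x + 1)"
  proof (rule tendsto_upperbound[OF phi_lim])
    show "\<forall>\<^sub>F t in at_top. \<phi> t \<le> \<phi> (x + 1)"
      using eventually_ge_at_top[of "x + 1"] by eventually_elim (use assms phi_antimono in auto)
  qed simp
  then show ?thesis
    using phi_strict_antimono[of x "x + 1"] assms by simp
qed

lemma phi_le: "x \<ge> 0 \<Longrightarrow> \<phi> x \<le> \<phi> 0"
  using phi_antimono[of 0 x] by simp

lemma slice_integrable:
  assumes x: "x \<ge> 0" and m: "m \<in> borel_measurable lebesgue" and bound: "\<And>\<xi>. \<bar>m \<xi>\<bar> \<le> B"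
  shows "integrable lebesgue (\<lambda>\<xi>. f x \<xi> * m \<xi>)"
  by (rule Bochner_Integration.integrable_bound[of _ "\<lambda>\<xi>. B * f x \<xi>"])
    (use f_int[OF x] m bound in \<open>auto simp: abs_mult mult.commute[of B]
      intro!: mult_left_mono order_trans[OF bound abs_ge_self]\<close>)

lemma slice_measurable:
  assumes m: "continuous_on phase_space (\<lambda>z. m (fst z) (snd z))" and x: "x \<ge> 0"
  shows "(m x :: real ^ 3 \<Rightarrow> real) \<in> borel_measurable lebesgue"
proof -
  have "continuous_on UNIV (\<lambda>\<xi>. m (fst (x, \<xi>)) (snd (x, \<xi>)))"
    by (rule continuous_on_compose2[OF m]) (use x in \<open>auto intro!: continuous_intros\<close>)
  then show ?thesis
    by (auto intro!: borel_measurable_continuous_onI measurable_completion)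
qed

lemma slice_integral_continuous:
  fixes m :: "real \<Rightarrow> real ^ 3 \<Rightarrow> real"
  assumes m: "continuous_on phase_space (\<lambda>z. m (fst z) (snd z))"
    and bound: "\<And>x \<xi>. x \<ge> 0 \<Longrightarrow> \<bar>m x \<xi>\<bar> \<le> B"
  shows "continuous_on half_line (\<lambda>x. LINT \<xi>|lebesgue. f x \<xi> * m x \<xi>)"
proof (rule continuous_on_sequentiallyI)
  fix u :: "nat \<Rightarrow> real" and a
  assume u: "\<forall>n. u n \<in> half_line" "u \<longlonglongrightarrow> a" and a: "a \<in> half_line"
  show "(\<lambda>n. LINT \<xi>|lebesgue. f (u n) \<xi> * m (u n) \<xi>) \<longlonglongrightarrow> (LINT \<xi>|lebesgue. f a \<xi> * m a \<xi>)"
  proof (rule integral_pairing_tendsto)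
    have "continuous (at a within half_line) (\<lambda>y. LINT \<xi>|lebesgue. \<bar>f y \<xi> - f a \<xi>\<bar>)"
      using curve a by (simp add: C_L1_def continuous_within)
    then show "(\<lambda>n. LINT \<xi>|lebesgue. \<bar>f (u n) \<xi> - f a \<xi>\<bar>) \<longlonglongrightarrow> 0"
      using u by (auto simp: continuous_within_sequentially o_def)
    show "(\<lambda>n. m (u n) \<xi>) \<longlonglongrightarrow> m a \<xi>" for \<xi>
    proof -
      have "(\<lambda>n. m (fst (u n, \<xi>)) (snd (u n, \<xi>))) \<longlonglongrightarrow> m (fst (a, \<xi>)) (snd (a, \<xi>))"
        by (rule continuous_on_tendsto_compose[OF m]) (use u a in \<open>auto intro!: tendsto_intros\<close>)
      then show ?thesis by simp
    qed
  qed (use u a bound in \<open>auto intro!: f_int slice_measurable[OF m]\<close>)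
qed

lemma slice_integral_tendsto:
  fixes m :: "real \<Rightarrow> real ^ 3 \<Rightarrow> real"
  assumes m: "continuous_on phase_space (\<lambda>z. m (fst z) (snd z))"
    and m0: "m0 \<in> borel_measurable lebesgue"
    and bound: "\<And>x \<xi>. x \<ge> 0 \<Longrightarrow> \<bar>m x \<xi>\<bar> \<le> B"
    and lim: "\<And>\<xi>. ((\<lambda>x. m x \<xi>) \<longlongrightarrow> m0 \<xi>) at_top"
  shows "(\<lambda>n. LINT \<xi>|lebesgue. f (real n) \<xi> * m (real n) \<xi>)
    \<longlonglongrightarrow> (LINT \<xi>|lebesgue. f_inf \<xi> * m0 \<xi>)"
  by (rule integral_pairing_tendsto[where B = B])
    (use f_inf_int m0 bound in \<open>auto intro!: f_int slice_measurable[OF m]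
      filterlim_compose[OF lim filterlim_real_sequentially]
      filterlim_compose[OF f_lim filterlim_real_sequentially]\<close>)

text \<open>A compactly supported continuous weight makes \<open>f\<close> integrable on phase space, because \<open>f\<close> is
  locally integrable up to the wall; slicing in \<open>x\<close> is then legitimate.\<close>
lemma phase_space_Fubini:
  fixes m :: "real \<Rightarrow> real ^ 3 \<Rightarrow> real"
  assumes m: "continuous_on phase_space (\<lambda>z. m (fst z) (snd z))"
    and supp: "\<And>x \<xi>. x \<ge> 0 \<Longrightarrow> m x \<xi> \<noteq> 0 \<Longrightarrow> x \<le> R \<and> (\<forall>i. \<bar>\<xi> $ i\<bar> \<le> R)"
  shows "\<exists>B. \<forall>x\<ge>0. \<forall>\<xi>. \<bar>m x \<xi>\<bar> \<le> B"
    and "set_integrable lebesgue {0<..} (\<lambda>x. LINT \<xi>|lebesgue. f x \<xi> * m x \<xi>)"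
    and "(LINT x:{0<..}|lebesgue. LINT \<xi>|lebesgue. f x \<xi> * m x \<xi>)
      = (LINT z:({0<..} \<times> UNIV)|lebesgue. f (fst z) (snd z) * m (fst z) (snd z))"
proof -
  define K where "K = {0..R} \<times> cbox (\<chi> i. - R) (\<chi> i. R :: real ^ 3)"
  have K: "compact K" "K \<subseteq> phase_space"
    by (auto simp: K_def intro!: compact_Times)
  have zero: "m (fst z) (snd z) = 0" if "z \<in> phase_space" "z \<notin> K" for z
    using that supp[of "fst z" "snd z"] by (cases z) (auto simp: K_def mem_box_cart abs_le_iff minus_le_iff)
  obtain B where B: "\<And>z. z \<in> K \<Longrightarrow> \<bar>m (fst z) (snd z)\<bar> \<le> B" "B \<ge> 0"
  proof -
    have "bounded ((\<lambda>z. m (fst z) (snd z)) ` K)"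
      by (rule compact_imp_bounded[OF compact_continuous_image[OF continuous_on_subset[OF m K(2)] K(1)]])
    then obtain B where "B > 0" "\<forall>y\<in>(\<lambda>z. m (fst z) (snd z)) ` K. norm y \<le> B"
      by (auto simp: bounded_pos)
    then show ?thesis
      using that[of B] by auto
  qed
  have bound: "\<bar>m (fst z) (snd z)\<bar> \<le> B" if "z \<in> phase_space" for z
    using B zero[OF that] by (cases "z \<in> K") auto
  show "\<exists>B. \<forall>x\<ge>0. \<forall>\<xi>. \<bar>m x \<xi>\<bar> \<le> B"
    using bound by force
  define S where "S = {0::real<..} \<times> (UNIV :: (real ^ 3) set)"
  have S: "S \<in> sets borel"
    unfolding S_def by (rule borel_open) (auto intro!: open_Times)
  define F where "F z = indicat_real S z * (f (fst z) (snd z) * m (fst z) (snd z))" for z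
  define M where "M z = indicat_real S z * (indicat_real K z * m (fst z) (snd z))" for z
  have "(\<lambda>z. indicat_real K z *\<^sub>R m (fst z) (snd z)) \<in> borel_measurable borel"
    by (rule borel_measurable_continuous_on_indicator)
      (use K m in \<open>auto intro!: borel_compact continuous_on_subset[OF m]\<close>)
  then have M: "M \<in> borel_measurable lebesgue"
    using S unfolding M_def[abs_def] by (auto intro!: measurable_completion)
  have fK: "integrable lebesgue (\<lambda>z. indicat_real K z * f (fst z) (snd z))"
    using loc K by (auto simp: L1_loc_def set_integrable_def)
  have F_eq: "F z = (indicat_real K z * f (fst z) (snd z)) * M z" for z
    using zero[of z] by (auto simp: F_def M_def S_def indicator_def)
  have "\<bar>M z\<bar> \<le> B" for z
    using B bound[of z] by (auto simp: M_def S_def indicator_def)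
  then have F: "integrable lebesgue F"
    unfolding F_eq[abs_def]
    by (intro Bochner_Integration.integrable_bound[OF integrable_mult_left[OF integrable_abs[OF fK], of B]])
      (use M fK in \<open>auto simp: abs_mult intro!: mult_left_mono order_trans[OF _ abs_ge_self]\<close>)
  have slice: "(\<lambda>\<xi>. F (x, \<xi>)) \<in> borel_measurable lebesgue" for x
    using slice_measurable[OF m, of x] f_int[of x]
    by (cases "x > 0") (auto simp: F_def S_def indicator_def)
  have inner: "(LINT \<xi>|lebesgue. F (x, \<xi>)) = indicat_real {0<..} x *\<^sub>R (LINT \<xi>|lebesgue. f x \<xi> * m x \<xi>)" for x
    by (auto simp: F_def S_def indicator_def)
  show "set_integrable lebesgue {0<..} (\<lambda>x. LINT \<xi>|lebesgue. f x \<xi> * m x \<xi>)"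
    using lebesgue_Fubini(1)[OF F slice] by (simp only: inner set_integrable_def)
  show "(LINT x:{0<..}|lebesgue. LINT \<xi>|lebesgue. f x \<xi> * m x \<xi>)
      = (LINT z:({0<..} \<times> UNIV)|lebesgue. f (fst z) (snd z) * m (fst z) (snd z))"
    using lebesgue_Fubini(2)[OF F slice, unfolded inner]
    by (simp add: set_lebesgue_integral_def F_def[abs_def] S_def)
qed

text \<open>The test function is \<open>\<psi> = \<zeta>(x) a(\<xi>\<^sub>1) k(E) b(\<xi>\<^sub>2) b(\<xi>\<^sub>3)\<close>. The transport operator is a derivation that
  annihilates \<open>E\<close>, \<open>\<xi>\<^sub>2\<close> and \<open>\<xi>\<^sub>3\<close>, so it only differentiates \<open>\<zeta>\<close> and \<open>a\<close>, and the result is \<open>m\<close>.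
  The condition \<open>bdry\<close> ensures what the test space demands for \<open>\<alpha> = 0\<close>: \<open>\<psi>\<close> vanishes at the
  wall for \<open>\<xi>\<^sub>1 < 0\<close>.\<close>
lemma product_test:
  fixes \<zeta> a k b :: "real \<Rightarrow> real"
  assumes \<zeta>: "\<And>t. (\<zeta> has_real_derivative \<zeta>' t) (at t)" "continuous_on UNIV \<zeta>'"
    and a: "\<And>t. (a has_real_derivative a' t) (at t)" "continuous_on UNIV a'"
    and k: "k C1_differentiable_on UNIV"
    and b: "b C1_differentiable_on UNIV"
    and b_supp: "\<And>t. b t \<noteq> 0 \<Longrightarrow> \<bar>t\<bar> \<le> R"
    and supp: "\<And>x y. x \<ge> 0 \<Longrightarrow> \<zeta> x \<noteq> 0 \<or> \<zeta>' x \<noteq> 0 \<Longrightarrow> k (y\<^sup>2 / 2 - \<phi> x) \<noteq> 0 \<Longrightarrow> x \<le> R \<and> \<bar>y\<bar> \<le> R"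
    and bdry: "\<zeta> 0 = 0 \<or> (\<forall>y<0. a y = 0)"
  defines "m x \<xi> \<equiv> (\<xi> $ 1 * \<zeta>' x * a (\<xi> $ 1) + p x * \<zeta> x * a' (\<xi> $ 1))
      * k ((\<xi> $ 1)\<^sup>2 / 2 - \<phi> x) * (b (\<xi> $ 2) * b (\<xi> $ 3))"
  shows "continuous_on half_line (\<lambda>x. LINT \<xi>|lebesgue. f x \<xi> * m x \<xi>)"
    and "set_integrable lebesgue {0<..} (\<lambda>x. LINT \<xi>|lebesgue. f x \<xi> * m x \<xi>)"
    and "(LINT x:{0<..}|lebesgue. LINT \<xi>|lebesgue. f x \<xi> * m x \<xi>) = 0"
    and "\<And>x. x \<ge> 0 \<Longrightarrow> integrable lebesgue (\<lambda>\<xi>. f x \<xi> * m x \<xi>)"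
proof -
  obtain k' where k': "\<And>t. (k has_real_derivative k' t) (at t)" "continuous_on UNIV k'"
    "continuous_on UNIV k"
    using C1_UNIV_D[OF k] by metis
  obtain b' where b': "\<And>t. (b has_real_derivative b' t) (at t)" "continuous_on UNIV b'"
    "continuous_on UNIV b"
    using C1_UNIV_D[OF b] by metis
  have \<zeta>_cont: "continuous_on UNIV \<zeta>" and a_cont: "continuous_on UNIV a"
    by (meson DERIV_isCont \<zeta>(1) a(1) continuous_at_imp_continuous_on)+
  let ?S = "phase_space"
  let ?E = "\<lambda>z. (snd z $ 1)\<^sup>2 / 2 - \<phi> (fst z)"
  have fst_S: "fst ` ?S = half_line"
    by force
  have phi_S: "continuous_on ?S (\<lambda>z. \<phi> (fst z))" "continuous_on ?S (\<lambda>z. p (fst z))"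
    by (auto intro!: continuous_on_compose2[OF phi_cont] continuous_on_compose2[OF p_cont]
        continuous_intros)
  have E_S: "continuous_on ?S ?E"
    by (intro continuous_intros phi_S) auto
  note comp = continuous_on_compose2[OF _ _ subset_UNIV]
  have c [continuous_intros]: "continuous_on ?S (\<lambda>z. \<zeta> (fst z))" "continuous_on ?S (\<lambda>z. \<zeta>' (fst z))"
    "continuous_on ?S (\<lambda>z. a (snd z $ 1))" "continuous_on ?S (\<lambda>z. a' (snd z $ 1))"
    "continuous_on ?S (\<lambda>z. k (?E z))" "continuous_on ?S (\<lambda>z. k' (?E z))"
    "continuous_on ?S (\<lambda>z. b (snd z $ i))" "continuous_on ?S (\<lambda>z. b' (snd z $ i))" for i
    by (auto intro!: comp[OF \<zeta>_cont] comp[OF \<zeta>(2)] comp[OF a_cont] comp[OF a(2)] comp[OF k'(2)]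
        comp[OF k'(3)] comp[OF b'(2)] comp[OF b'(3)] E_S continuous_intros)
  have m_cont: "continuous_on ?S (\<lambda>z. m (fst z) (snd z))"
    unfolding m_def by (intro continuous_intros phi_S) 
  have m_supp: "x \<le> R \<and> (\<forall>i. \<bar>\<xi> $ i\<bar> \<le> R)" if "x \<ge> 0" "m x \<xi> \<noteq> 0" for x \<xi>
  proof -
    have "\<zeta> x \<noteq> 0 \<or> \<zeta>' x \<noteq> 0"
      using that by (auto simp: m_def)
    then show ?thesis
      using that supp[of x "\<xi> $ 1"] b_supp[of "\<xi> $ 2"] b_supp[of "\<xi> $ 3"]
      by (simp add: m_def forall_3)
  qed
  obtain B where B: "\<And>x \<xi>. x \<ge> 0 \<Longrightarrow> \<bar>m x \<xi>\<bar> \<le> B"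
    using phase_space_Fubini(1)[OF m_cont m_supp] by blast
  show "continuous_on half_line (\<lambda>x. LINT \<xi>|lebesgue. f x \<xi> * m x \<xi>)"
    by (rule slice_integral_continuous[OF m_cont B])
  show "set_integrable lebesgue {0<..} (\<lambda>x. LINT \<xi>|lebesgue. f x \<xi> * m x \<xi>)"
    by (rule phase_space_Fubini(2)[OF m_cont m_supp])
  show "integrable lebesgue (\<lambda>\<xi>. f x \<xi> * m x \<xi>)" if "x \<ge> 0" for x
    by (rule slice_integrable[OF that slice_measurable[OF m_cont that] B[OF that]])

  define \<psi> where "\<psi> z = \<zeta> (fst z) * a (snd z $ 1) * k (?E z) * (b (snd z $ 2) * b (snd z $ 3))" for z :: "real \<times> (real ^ 3)"
  \<comment> \<open>The coefficients of the differential of \<open>\<psi>\<close> along \<open>x\<close>, \<open>\<xi>\<^sub>1\<close>, \<open>\<xi>\<^sub>2\<close>, \<open>\<xi>\<^sub>3\<close>.\<close>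
  define c0 where "c0 z = (\<zeta>' (fst z) * k (?E z) - \<zeta> (fst z) * k' (?E z) * p (fst z))
    * a (snd z $ 1) * (b (snd z $ 2) * b (snd z $ 3))" for z :: "real \<times> (real ^ 3)"
  define c1 where "c1 z = \<zeta> (fst z) * (a' (snd z $ 1) * k (?E z) + a (snd z $ 1) * k' (?E z) * snd z $ 1)
    * (b (snd z $ 2) * b (snd z $ 3))" for z :: "real \<times> (real ^ 3)"
  define c2 where "c2 z = \<zeta> (fst z) * a (snd z $ 1) * k (?E z) * (b' (snd z $ 2) * b (snd z $ 3))" for z :: "real \<times> (real ^ 3)"
  define c3 where "c3 z = \<zeta> (fst z) * a (snd z $ 1) * k (?E z) * (b (snd z $ 2) * b' (snd z $ 3))" for z :: "real \<times> (real ^ 3)"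
  have \<psi>': "(\<psi> has_derivative
      (\<lambda>h. c0 z * fst h + c1 z * snd h $ 1 + c2 z * snd h $ 2 + c3 z * snd h $ 3)) (at z within ?S)"
    if z: "z \<in> ?S" for z
  proof -
    have d_fst: "(fst has_derivative fst) (at z within ?S)"
      by (rule bounded_linear_imp_has_derivative[OF bounded_linear_fst])
    have d_comp: "((\<lambda>z. snd z $ i) has_derivative (\<lambda>h. snd h $ i)) (at z within ?S)" for i
      by (rule bounded_linear_imp_has_derivative)
        (rule bounded_linear_compose[OF bounded_linear_vec_nth bounded_linear_snd])
    have "(\<phi> has_derivative (*) (p (fst z))) (at (fst z) within fst ` ?S)"
      using phi_deriv[of "fst z"] z by (auto simp: fst_S has_field_derivative_def)
    then have d_phi: "((\<lambda>z. \<phi> (fst z)) has_derivative (\<lambda>h. p (fst z) * fst h)) (at z within ?S)"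
      by (rule has_derivative_in_compose[OF d_fst])
    have d_E: "(?E has_derivative (\<lambda>h. snd z $ 1 * snd h $ 1 - p (fst z) * fst h)) (at z within ?S)"
      by (rule derivative_eq_intros d_phi d_comp refl | simp add: mult.commute)+
    have expand: "(Z * A * K) * (B * (v3 * C') + (v2 * B') * C)
          + ((Z * A) * ((x1 * v1 - P * y) * K') + (Z * (v1 * A') + (y * Z') * A) * K) * (B * C)
        = ((Z' * K - Z * K' * P) * A * (B * C)) * y + (Z * (A' * K + A * K' * x1) * (B * C)) * v1
          + (Z * A * K * (B' * C)) * v2 + (Z * A * K * (B * C')) * v3"
      for Z A K B C Z' A' K' B' C' P y v1 v2 v3 x1 :: real
      by (simp add: algebra_simps)
    note deriv = has_derivative_mult[OF
        has_derivative_mult[OF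
          has_derivative_mult[OF DERIV_compose_FDERIV[OF \<zeta>(1) d_fst] DERIV_compose_FDERIV[OF a(1) d_comp]]
          DERIV_compose_FDERIV[OF k'(1) d_E]]
        has_derivative_mult[OF DERIV_compose_FDERIV[OF b'(1) d_comp] DERIV_compose_FDERIV[OF b'(1) d_comp]],
        of 1 2 3]
    show ?thesis
      unfolding \<psi>_def[abs_def] c0_def c1_def c2_def c3_def
      by (rule has_derivative_eq_rhs[OF deriv], rule ext, rule expand)
  qed
  have bl: "bounded_linear (\<lambda>h::real \<times> (real ^ 3). snd h $ i)" for i
    by (rule bounded_linear_compose[OF bounded_linear_vec_nth bounded_linear_snd])
  have C1: "C1_on ?S \<psi>"
    unfolding C1_on_def
  proof (intro exI conjI ballI)
    let ?L = "\<lambda>i. Blinfun (\<lambda>h::real \<times> (real ^ 3). snd h $ i)"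
    let ?g = "\<lambda>z. c0 z *\<^sub>R Blinfun fst + c1 z *\<^sub>R ?L 1 + c2 z *\<^sub>R ?L 2 + c3 z *\<^sub>R ?L 3"
    show "continuous_on ?S ?g"
      unfolding c0_def c1_def c2_def c3_def by (intro continuous_intros phi_S)
    fix z assume "z \<in> ?S"
    have "blinfun_apply (?g z)
        = (\<lambda>h. c0 z * fst h + c1 z * snd h $ 1 + c2 z * snd h $ 2 + c3 z * snd h $ 3)"
      by (simp add: fun_eq_iff blinfun.add_left blinfun.scaleR_left bounded_linear_Blinfun_apply
          bounded_linear_fst bl)
    then show "(\<psi> has_derivative blinfun_apply (?g z)) (at z within ?S)"
      using \<psi>'[OF \<open>z \<in> ?S\<close>] by simp
  qed
  have supp_\<psi>: "compact (closure {z \<in> ?S. \<psi> z \<noteq> 0})"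
  proof (subst compact_closure, rule bounded_subset)
    show "bounded ({0..R} \<times> cbox (\<chi> i. - R) (\<chi> i. R :: real ^ 3))"
      by (intro bounded_Times bounded_cbox) simp
    show "{z \<in> ?S. \<psi> z \<noteq> 0} \<subseteq> {0..R} \<times> cbox (\<chi> i. - R) (\<chi> i. R)"
    proof
      fix z assume z: "z \<in> {z \<in> ?S. \<psi> z \<noteq> 0}"
      then show "z \<in> {0..R} \<times> cbox (\<chi> i. - R) (\<chi> i. R)"
        using supp[of "fst z" "snd z $ 1"] b_supp[of "snd z $ 2"] b_supp[of "snd z $ 3"]
        by (cases z) (auto simp: \<psi>_def mem_box_cart forall_3 abs_le_iff)
    qed
  qed
  have test: "VP_test 0 \<psi>"
    unfolding VP_test_def using C1 supp_\<psi> bdry by (auto simp: \<psi>_def reflect_def)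
  have T: "snd z $ 1 * d_x \<psi> z + p (fst z) * d_xi1 \<psi> z = m (fst z) (snd z)"
    if z: "z \<in> {0<..} \<times> UNIV" for z
  proof -
    have "z \<in> interior ?S"
      using z by (cases z) (simp add: interior_Times)
    then have at: "at z within ?S = at z"
      by (rule at_within_interior)
    have "z \<in> ?S"
      using z by auto
    have "(\<psi> has_derivative
        (\<lambda>h. c0 z * fst h + c1 z * snd h $ 1 + c2 z * snd h $ 2 + c3 z * snd h $ 3)) (at z)"
      using \<psi>'[OF \<open>z \<in> ?S\<close>] unfolding at .
    then have D: "frechet_derivative \<psi> (at z)
        = (\<lambda>h. c0 z * fst h + c1 z * snd h $ 1 + c2 z * snd h $ 2 + c3 z * snd h $ 3)"
      by (rule frechet_derivative_at[symmetric])
    have "d_x \<psi> z = c0 z" "d_xi1 \<psi> z = c1 z"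
      unfolding d_x_def d_xi1_def D by (simp_all add: axis_def)
    \<comment> \<open>The two terms with \<open>k'\<close> cancel: this is conservation of energy.\<close>
    moreover have "x1 * ((Z' * K - Z * K' * P) * A * C) + P * (Z * (A' * K + A * K' * x1) * C)
        = (x1 * Z' * A + P * Z * A') * K * C" for x1 Z Z' K K' A A' P C :: real
      by (simp add: algebra_simps)
    ultimately show ?thesis
      by (simp only: c0_def c1_def m_def)
  qed
  have "(LINT z:({0<..} \<times> UNIV)|lebesgue. f (fst z) (snd z) * m (fst z) (snd z))
      = (LINT z:({0<..} \<times> UNIV)|lebesgue.
           f (fst z) (snd z) * (snd z $ 1 * d_x \<psi> z + p (fst z) * d_xi1 \<psi> z))"
    unfolding set_lebesgue_integral_def
    by (rule Bochner_Integration.integral_cong) (use T in \<open>auto simp: indicator_def\<close>)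
  also have "\<dots> = 0"
    by (rule weak[OF test])
  finally show "(LINT x:{0<..}|lebesgue. LINT \<xi>|lebesgue. f x \<xi> * m x \<xi>) = 0"
    using phase_space_Fubini(3)[OF m_cont m_supp] by simp
qed

end

section \<open>Trapped particles\<close>

definition bump :: "real \<Rightarrow> real \<Rightarrow> real" where
  "bump n t = pos_sq (1 - (t / n)\<^sup>2)"

lemma C1_UNIV_compose:
  fixes g h :: "real \<Rightarrow> real"
  assumes "g C1_differentiable_on UNIV" "h C1_differentiable_on UNIV"
  shows "(\<lambda>t. g (h t)) C1_differentiable_on UNIV"
proof -
  obtain g' where g': "\<And>t. (g has_real_derivative g' t) (at t)" "continuous_on UNIV g'"
    using C1_UNIV_D[OF assms(1)] by metis
  obtain h' where h': "\<And>t. (h has_real_derivative h' t) (at t)" "continuous_on UNIV h'"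
    "continuous_on UNIV h"
    using C1_UNIV_D[OF assms(2)] by metis
  show ?thesis
  proof (rule C1_UNIV_I)
    show "((\<lambda>t. g (h t)) has_real_derivative g' (h t) * h' t) (at t)" for t
      by (rule DERIV_chain2[OF g'(1) h'(1)])
    show "continuous_on UNIV (\<lambda>t. g' (h t) * h' t)"
      by (intro continuous_intros continuous_on_compose2[OF g'(2)] h') auto
  qed
qed

lemma C1_pos_sq: "pos_sq C1_differentiable_on UNIV"
  by (rule C1_UNIV_I[OF has_derivative_pos_sq]) (intro continuous_intros)

lemma C1_bump:
  assumes "n > 0"
  shows "bump n C1_differentiable_on UNIV"
  unfolding bump_def[abs_def]
proof (rule C1_UNIV_compose[OF C1_pos_sq C1_UNIV_I])
  show "((\<lambda>t. 1 - (t / n)\<^sup>2) has_real_derivative - (2 * t / n\<^sup>2)) (at t)" for t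
    using assms by (auto intro!: derivative_eq_intros simp: power2_eq_square field_simps)
  show "continuous_on UNIV (\<lambda>t. - (2 * t / n\<^sup>2))"
    using assms by (intro continuous_intros) auto
qed

lemma bump_nonneg: "bump n t \<ge> 0"
  by (simp add: bump_def pos_sq_nonneg)

lemma bump_pos_iff: "n > 0 \<Longrightarrow> bump n t > 0 \<longleftrightarrow> \<bar>t\<bar> < n"
  using abs_square_less_1[of "t / n"] by (simp add: bump_def pos_sq_pos_iff)

lemma bump_eq_0_iff: "n > 0 \<Longrightarrow> bump n t = 0 \<longleftrightarrow> n \<le> \<bar>t\<bar>"
  using bump_pos_iff[of n t] bump_nonneg[of n t] by linarith

context vlasov_sheath
begin

text \<open>How a test function whose image under the transport operator has a sign forces \<open>f\<close> to vanish.\<close>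
lemma nonneg_slices_vanish:
  fixes m :: "real \<Rightarrow> real ^ 3 \<Rightarrow> real"
  assumes cont: "continuous_on half_line (\<lambda>x. LINT \<xi>|lebesgue. f x \<xi> * m x \<xi>)"
    and int: "set_integrable lebesgue {0<..} (\<lambda>x. LINT \<xi>|lebesgue. f x \<xi> * m x \<xi>)"
    and zero: "(LINT x:{0<..}|lebesgue. LINT \<xi>|lebesgue. f x \<xi> * m x \<xi>) = 0"
    and slice: "\<And>x. x \<ge> 0 \<Longrightarrow> integrable lebesgue (\<lambda>\<xi>. f x \<xi> * m x \<xi>)"
    and nonneg: "\<And>x. x > 0 \<Longrightarrow> AE \<xi> in lebesgue. 0 \<le> f x \<xi> * m x \<xi>"
    and x: "x > 0"
  shows "AE \<xi> in lebesgue. f x \<xi> * m x \<xi> = 0"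
proof -
  have "(LINT \<xi>|lebesgue. f x \<xi> * m x \<xi>) = 0"
  proof (rule nonneg_continuous_integral_0_imp_0[OF _ _ _ int zero])
    show "continuous_on {0<..} (\<lambda>x. LINT \<xi>|lebesgue. f x \<xi> * m x \<xi>)"
      by (rule continuous_on_subset[OF cont]) auto
    show "0 \<le> (LINT \<xi>|lebesgue. f y \<xi> * m y \<xi>)" if "y \<in> {0<..}" for y
      by (rule integral_nonneg_AE) (use nonneg that in auto)
  qed (use x in auto)
  then show ?thesis
    using integral_nonneg_eq_0_iff_AE[OF slice nonneg, of x] x by simp
qed

text \<open>Negative energy confines a particle to the region where \<open>\<phi>\<close> exceeds \<open>c\<close>, which is bounded because
  \<open>\<phi>\<close> tends to 0. So a cut-off in the energy alone gives compact support in \<open>(x, \<xi>\<^sub>1)\<close>.\<close>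
lemma trapped_bounded:
  assumes "c > 0"
  shows "\<exists>R. \<forall>x\<ge>0. \<forall>y. y\<^sup>2 / 2 - \<phi> x < - c \<longrightarrow> x \<le> R \<and> \<bar>y\<bar> \<le> R"
proof -
  have "\<forall>\<^sub>F x in at_top. \<phi> x < c"
    using phi_lim assms by (rule order_tendstoD)
  then obtain X where X: "\<And>x. x \<ge> X \<Longrightarrow> \<phi> x < c"
    by (auto simp: eventually_at_top_linorder)
  have "x \<le> max X (2 * \<phi> 0 + 1) \<and> \<bar>y\<bar> \<le> max X (2 * \<phi> 0 + 1)"
    if "x \<ge> 0" "y\<^sup>2 / 2 - \<phi> x < - c" for x y
  proof -
    have "c < \<phi> x"
      using that(2) zero_le_power2[of y] by linarith
    then have "x \<le> X"
      using X[of x] by (cases "x \<ge> X") auto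
    moreover have "y\<^sup>2 \<le> 2 * \<phi> 0"
      using that phi_le[of x] assms by simp
    then have "\<bar>y\<bar> \<le> 2 * \<phi> 0 + 1"
      using zero_le_power2[of "\<bar>y\<bar> - 1"] unfolding power2_diff by simp
    ultimately show ?thesis by linarith
  qed
  then show ?thesis by blast
qed

lemma C1_trapping_cutoff: "(\<lambda>E. pos_sq (- E - c)) C1_differentiable_on UNIV"
  by (rule C1_UNIV_compose[OF C1_pos_sq], rule C1_UNIV_I[of _ "\<lambda>t. - 1"])
    (auto intro!: derivative_eq_intros continuous_intros)

text \<open>Two tests. With \<open>\<zeta> = 1\<close> and \<open>a = - pos_sq\<close>, which vanishes on the velocities where the boundary condition
  bites, the integrand is nonnegative because \<open>p < 0\<close>; this removes \<open>\<xi>\<^sub>1 > 0\<close>. On the remaining half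
  \<open>\<xi>\<^sub>1 \<le> 0\<close> the choice \<open>\<zeta> x = - x\<close>, \<open>a = 1\<close> yields the nonnegative integrand \<open>- \<xi>\<^sub>1 f\<close>.\<close>
lemma trapped_cutoff_vanish:
  assumes c: "c > 0" and n: "n > 0" and x0: "x0 > 0"
  shows "AE \<xi> in lebesgue. f x0 \<xi> * (\<xi> $ 1 * pos_sq (- ((\<xi> $ 1)\<^sup>2 / 2 - \<phi> x0) - c)
      * (bump n (\<xi> $ 2) * bump n (\<xi> $ 3))) = 0"
proof -
  define w where "w x \<xi> = pos_sq (- ((\<xi> $ 1)\<^sup>2 / 2 - \<phi> x) - c) * (bump n (\<xi> $ 2) * bump n (\<xi> $ 3))"
    for x and \<xi> :: "real ^ 3"
  have w: "w x \<xi> \<ge> 0" for x \<xi>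
    by (simp add: w_def pos_sq_nonneg bump_nonneg)
  obtain R where R: "\<And>x y. x \<ge> 0 \<Longrightarrow> y\<^sup>2 / 2 - \<phi> x < - c \<Longrightarrow> x \<le> R \<and> \<bar>y\<bar> \<le> R"
    using trapped_bounded[OF c] by metis
  have supp: "y \<le> max R n \<and> \<bar>t\<bar> \<le> max R n"
    if "y \<ge> 0" "P" "pos_sq (- (t\<^sup>2 / 2 - \<phi> y) - c) \<noteq> 0" for y t P
    using R[of y t] that by (auto simp: pos_sq_eq_0_iff)
  have b_supp: "\<bar>t\<bar> \<le> max R n" if "bump n t \<noteq> 0" for t
    using that n by (auto simp: bump_eq_0_iff)
  have right: "AE \<xi> in lebesgue. f x \<xi> * (- (p x) * (2 * max 0 (\<xi> $ 1)) * w x \<xi>) = 0"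
    if x: "x > 0" for x
  proof -
    have d: "((\<lambda>t. 1) has_real_derivative 0) (at t)"
      "((\<lambda>t. - pos_sq t) has_real_derivative - (2 * max 0 t)) (at t)" for t :: real
      by (auto intro!: derivative_eq_intros)
    have cont: "continuous_on UNIV (\<lambda>t::real. - (2 * max 0 t))"
      by (intro continuous_intros)
    have bdry: "(1::real) = 0 \<or> (\<forall>t<0. - pos_sq t = 0)"
      by (simp add: pos_sq_eq_0_iff)
    define m where "m x \<xi> = (\<xi> $ 1 * 0 * - pos_sq (\<xi> $ 1) + p x * 1 * - (2 * max 0 (\<xi> $ 1)))
        * pos_sq (- ((\<xi> $ 1)\<^sup>2 / 2 - \<phi> x) - c) * (bump n (\<xi> $ 2) * bump n (\<xi> $ 3))"
      for x and \<xi> :: "real ^ 3"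
    have m: "m x \<xi> = - (p x) * (2 * max 0 (\<xi> $ 1)) * w x \<xi>" for x \<xi>
      by (simp add: m_def w_def)
    note * = product_test[OF d(1) continuous_on_const d(2) cont C1_trapping_cutoff[of c] C1_bump[OF n]
        b_supp supp bdry, folded m_def]
    show ?thesis
      unfolding m[symmetric]
    proof (rule nonneg_slices_vanish[OF * _ x])
      fix x :: real assume x: "x > 0"
      have "0 \<le> m x \<xi>" for \<xi>
        unfolding m using x p_neg[of x] w[of x \<xi>] by (intro mult_nonneg_nonneg) auto
      then show "AE \<xi> in lebesgue. 0 \<le> f x \<xi> * m x \<xi>"
        using f_nonneg[of x] x by auto
    qed
  qed
  have d: "((\<lambda>t. - t) has_real_derivative - 1) (at t)" "((\<lambda>t. 1) has_real_derivative 0) (at t)"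
    for t :: real
    by (auto intro!: derivative_eq_intros)
  have bdry: "- (0::real) = 0 \<or> (\<forall>t<0::real. (1::real) = 0)"
    by simp
  define m where "m x \<xi> = (\<xi> $ 1 * - 1 * 1 + p x * - x * 0) * pos_sq (- ((\<xi> $ 1)\<^sup>2 / 2 - \<phi> x) - c)
      * (bump n (\<xi> $ 2) * bump n (\<xi> $ 3))" for x and \<xi> :: "real ^ 3"
  have m: "m x \<xi> = - (\<xi> $ 1) * w x \<xi>" for x \<xi>
    by (simp add: m_def w_def)
  note * = product_test[OF d(1) continuous_on_const d(2) continuous_on_const C1_trapping_cutoff[of c]
      C1_bump[OF n] b_supp supp bdry, folded m_def]
  have "AE \<xi> in lebesgue. f x0 \<xi> * m x0 \<xi> = 0"
  proof (rule nonneg_slices_vanish[OF * _ x0])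
    fix x :: real assume x: "x > 0"
    show "AE \<xi> in lebesgue. 0 \<le> f x \<xi> * m x \<xi>"
      using right[OF x] f_nonneg[OF less_imp_le[OF x]]
    proof eventually_elim
      case (elim \<xi>)
      show ?case
      proof (cases "\<xi> $ 1 > 0")
        case True
        then have "f x \<xi> * w x \<xi> = 0"
          using elim(1) p_neg[of x] x by simp
        then have "f x \<xi> * m x \<xi> = 0"
          unfolding m by auto
        then show ?thesis by (rule eq_refl[OF sym])
      next
        case False
        then have "0 \<le> - (\<xi> $ 1) * w x \<xi>"
          using w[of x \<xi>] by (intro mult_nonneg_nonneg) auto
        then show ?thesis
          unfolding m by (rule mult_nonneg_nonneg[OF elim(2)])
      qed
    qed
  qed
  then show ?thesis
    unfolding m w_def by eventually_elim (simp only: mult_minus_left mult_minus_right neg_equal_0_iff_equal mult.assoc)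
qed

end

section \<open>Untrapped particles\<close>

lemma bump_le_1: "bump n t \<le> 1"
  unfolding bump_def pos_sq_def by (rule power_le_one) auto

context vlasov_sheath
begin

lemma energy_continuous: "continuous_on phase_space (\<lambda>z. (snd z $ 1)\<^sup>2 / 2 - \<phi> (fst z))"
  by (intro continuous_intros continuous_on_compose2[OF phi_cont]) auto

lemma kinetic_energy_bounded:
  assumes "x \<ge> 0" "y\<^sup>2 / 2 - \<phi> x < C" "C \<ge> 0"
  shows "\<bar>y\<bar> \<le> 2 * (C + \<phi> 0) + 1"
  using assms phi_le[of x] zero_le_power2[of "\<bar>y\<bar> - 1"] phi_pos[of 0] unfolding power2_diff
  by simp

text \<open>For \<open>E \<ge> c > 0\<close> one has \<open>\<bar>\<xi>\<^sub>1\<bar> \<ge> sqrt (2 c)\<close>, so the indicator of \<open>s * \<xi>\<^sub>1 > 0\<close> can be replaced by a smooth step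
  \<open>a\<close> whose derivative is supported where \<open>k(E) = 0\<close>. With arbitrary \<open>\<zeta>\<close> compactly supported in \<open>x > 0\<close> the weak equation then says that
  the flux \<open>g\<close> has zero distributional derivative; its constant value is the limit at infinity.\<close>
lemma conserved_pairing:
  assumes s: "s = 1 \<or> s = (- 1 :: real)" and k: "k C1_differentiable_on UNIV"
    and k_low: "\<And>E. E \<le> c \<Longrightarrow> k E = 0" and k_high: "\<And>E. E \<ge> C \<Longrightarrow> k E = 0"
    and c: "c > 0" "c \<le> C" and n: "n > 0" and x0: "x0 > 0"
  defines "M x \<xi> \<equiv> \<xi> $ 1 * of_bool (s * \<xi> $ 1 > 0) * k ((\<xi> $ 1)\<^sup>2 / 2 - \<phi> x)
      * (bump n (\<xi> $ 2) * bump n (\<xi> $ 3))"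
    and "M_inf \<xi> \<equiv> \<xi> $ 1 * of_bool (s * \<xi> $ 1 > 0) * k ((\<xi> $ 1)\<^sup>2 / 2)
      * (bump n (\<xi> $ 2) * bump n (\<xi> $ 3))"
  shows "integrable lebesgue (\<lambda>\<xi>. f x0 \<xi> * M x0 \<xi>)"
    and "(LINT \<xi>|lebesgue. f x0 \<xi> * M x0 \<xi>) = (LINT \<xi>|lebesgue. f_inf \<xi> * M_inf \<xi>)"
proof -
  have k_cont: "continuous_on UNIV k"
    using C1_UNIV_D[OF k] by metis
  \<comment> \<open>The step \<open>a\<close> rises from 0 to 1 for \<open>s * t\<close> between \<open>0\<close> and \<open>2 * r = sqrt (2 * c)\<close>.\<close>
  define r where "r = sqrt (c / 2)"
  have r: "r > 0" "(2 * r)\<^sup>2 = 2 * c"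
    using c by (auto simp: r_def power_mult_distrib)
  define a where "a t = smooth_step r (s * t - r)" for t
  define a' where "a' t = s * tent r (s * t - r)" for t
  have a_deriv: "(a has_real_derivative a' t) (at t)" for t
    unfolding a_def[abs_def] a'_def
    by (rule DERIV_chain2[OF has_derivative_smooth_step[OF r(1)], THEN DERIV_cong])
      (auto intro!: derivative_eq_intros)
  have a'_cont: "continuous_on UNIV a'"
    unfolding a'_def[abs_def] by (intro continuous_intros)
  have a_cont: "continuous_on UNIV a"
    by (meson DERIV_isCont a_deriv continuous_at_imp_continuous_on)
  have step: "a t * k E = of_bool (s * t > 0) * k E" "a' t * k E = 0" if E: "E \<le> t\<^sup>2 / 2" for t E
  proof -
    have "a t = of_bool (s * t > 0) \<and> a' t = 0" if "k E \<noteq> 0"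
    proof -
      have "(2 * r)\<^sup>2 < (s * t)\<^sup>2"
        using that k_low[of E] E r s by (auto simp: power_mult_distrib not_le[symmetric])
      then have "2 * r < \<bar>s * t\<bar>"
        by (intro power2_less_imp_less[of "2 * r" "\<bar>s * t\<bar>"]) simp_all
      then consider "s * t - r \<ge> r" | "s * t - r \<le> - r" "s * t < 0"
        using r by (cases "s * t > 0") auto
      then show ?thesis
        by cases (use r in \<open>auto simp: a_def a'_def smooth_step_eq_0 smooth_step_eq_1 tent_eq_0\<close>)
    qed
    then show "a t * k E = of_bool (s * t > 0) * k E" "a' t * k E = 0"
      by (cases "k E = 0"; simp)+
  qed
  have E_le: "t\<^sup>2 / 2 - \<phi> x \<le> t\<^sup>2 / 2" if "x \<ge> 0" for t x
    using phi_pos[OF that] by simp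
  \<comment> \<open>\<open>N\<close> is the smooth version of \<open>M\<close>; the two agree since \<open>k\<close> vanishes where \<open>a\<close> varies.\<close>
  define N where "N x \<xi> = \<xi> $ 1 * a (\<xi> $ 1) * k ((\<xi> $ 1)\<^sup>2 / 2 - \<phi> x)
      * (bump n (\<xi> $ 2) * bump n (\<xi> $ 3))" for x and \<xi> :: "real ^ 3"
  have N_M: "N x \<xi> = M x \<xi>" if "x \<ge> 0" for x \<xi>
    using step(1)[OF E_le[OF that], of "\<xi> $ 1"] by (auto simp: N_def M_def)
  define N_inf where "N_inf \<xi> = \<xi> $ 1 * a (\<xi> $ 1) * k ((\<xi> $ 1)\<^sup>2 / 2)
      * (bump n (\<xi> $ 2) * bump n (\<xi> $ 3))" for \<xi> :: "real ^ 3"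
  have N_M_inf: "N_inf \<xi> = M_inf \<xi>" for \<xi>
    using step(1)[OF order_refl, of "\<xi> $ 1"] by (auto simp: N_inf_def M_inf_def)
  note comp = continuous_on_compose2[OF _ _ subset_UNIV]
  have bump_cont: "continuous_on UNIV (bump n)"
    using C1_UNIV_D[OF C1_bump[OF n]] by metis
  have N_cont: "continuous_on phase_space (\<lambda>z. N (fst z) (snd z))"
    unfolding N_def
    by (intro continuous_intros comp[OF a_cont] comp[OF k_cont energy_continuous] comp[OF bump_cont])
  have N_inf_meas: "N_inf \<in> borel_measurable lebesgue"
  proof -
    have "continuous_on UNIV N_inf"
      unfolding N_inf_def[abs_def]
      by (intro continuous_intros comp[OF a_cont] comp[OF k_cont] comp[OF bump_cont]) simp_all
    then show ?thesis
      by (auto intro!: measurable_completion borel_measurable_continuous_onI)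
  qed
  obtain B where B: "\<And>x \<xi>. x \<ge> 0 \<Longrightarrow> \<bar>N x \<xi>\<bar> \<le> B"
  proof -
    have "bounded (k ` {c..C})"
      by (intro compact_imp_bounded compact_continuous_image continuous_on_subset[OF k_cont]) auto
    then obtain K where "K > 0" "\<forall>y\<in>k ` {c..C}. norm y \<le> K"
      by (auto simp: bounded_pos)
    then have K: "\<bar>k E\<bar> \<le> K" for E
      using k_low[of E] k_high[of E] by (cases "E \<in> {c..C}") auto
    define Y where "Y = 2 * (C + \<phi> 0) + 1"
    have "\<bar>N x \<xi>\<bar> \<le> Y * K" if x: "x \<ge> 0" for x \<xi>
    proof (cases "k ((\<xi> $ 1)\<^sup>2 / 2 - \<phi> x) = 0")
      case True
      then show ?thesis
        using \<open>K > 0\<close> c phi_pos[of 0] by (simp add: N_def Y_def)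
    next
      case False
      then have Y: "\<bar>\<xi> $ 1\<bar> \<le> Y"
        unfolding Y_def using k_high[of "(\<xi> $ 1)\<^sup>2 / 2 - \<phi> x"] c
        by (intro kinetic_energy_bounded[OF x]) (auto simp: not_le[symmetric])
      have "\<bar>N x \<xi>\<bar> \<le> ((Y * 1) * K) * (1 * 1)"
        unfolding N_M[OF x] M_def abs_mult
        using Y K bump_nonneg[of n] bump_le_1[of n] \<open>K > 0\<close>
        by (intro mult_mono) (auto intro!: mult_nonneg_nonneg order_trans[OF abs_ge_zero Y])
      then show ?thesis by simp
    qed
    then show ?thesis by (rule that)
  qed
  define g where "g x = (LINT \<xi>|lebesgue. f x \<xi> * N x \<xi>)" for x
  have g_cont: "continuous_on half_line g"
    unfolding g_def[abs_def] by (rule slice_integral_continuous[OF N_cont B])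
  have const: "g x1 = g x2" if pos: "x1 > 0" "x2 > 0" for x1 x2
  proof (rule const_if_tent_averages_agree[OF _ _ pos])
    show "continuous_on {0<..} g"
      by (rule continuous_on_subset[OF g_cont]) auto
    fix \<rho> :: real assume \<rho>: "0 < \<rho>" "\<rho> < x1" "\<rho> < x2"
    define \<zeta> where "\<zeta> t = smooth_step \<rho> (t - x1) - smooth_step \<rho> (t - x2)" for t
    define \<zeta>' where "\<zeta>' t = tent \<rho> (t - x1) - tent \<rho> (t - x2)" for t
    have shift: "((\<lambda>t. smooth_step \<rho> (t - y)) has_real_derivative tent \<rho> (t - y)) (at t)" for t y
      by (rule DERIV_chain2[OF has_derivative_smooth_step[OF \<rho>(1)], THEN DERIV_cong])
        (auto intro!: derivative_eq_intros)
    have \<zeta>: "(\<zeta> has_real_derivative \<zeta>' t) (at t)" for t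
      unfolding \<zeta>_def[abs_def] \<zeta>'_def by (intro DERIV_diff shift)
    have \<zeta>'_cont: "continuous_on UNIV \<zeta>'"
      unfolding \<zeta>'_def[abs_def] by (intro continuous_intros)
    define R where "R = max (max x1 x2 + \<rho>) (max (2 * (C + \<phi> 0) + 1) n)"
    have b_supp: "\<bar>t\<bar> \<le> R" if "bump n t \<noteq> 0" for t
      using that n by (auto simp: bump_eq_0_iff R_def)
    have supp: "x \<le> R \<and> \<bar>y\<bar> \<le> R"
      if x: "x \<ge> 0" and "\<zeta> x \<noteq> 0 \<or> \<zeta>' x \<noteq> 0" and "k (y\<^sup>2 / 2 - \<phi> x) \<noteq> 0" for x y
    proof
      have "\<zeta> x = 0 \<and> \<zeta>' x = 0" if "x > max x1 x2 + \<rho>"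
        using that \<rho> by (auto simp: \<zeta>_def \<zeta>'_def smooth_step_eq_1 tent_eq_0)
      then show "x \<le> R"
        using that(2) unfolding R_def by (meson le_max_iff_disj linorder_not_less)
      have "y\<^sup>2 / 2 - \<phi> x < C"
        using that(3) k_high by (meson not_le)
      from kinetic_energy_bounded[OF x this] show "\<bar>y\<bar> \<le> R"
        using c by (simp add: R_def)
    qed
    have bdry: "\<zeta> 0 = 0 \<or> (\<forall>y<0. a y = 0)"
      using \<rho> by (simp add: \<zeta>_def smooth_step_eq_0)
    have "(LINT x:{0<..}|lebesgue. \<zeta>' x * g x)
      = (LINT x:{0<..}|lebesgue. LINT \<xi>|lebesgue. f x \<xi> *
        ((\<xi> $ 1 * \<zeta>' x * a (\<xi> $ 1) + p x * \<zeta> x * a' (\<xi> $ 1))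
      * k ((\<xi> $ 1)\<^sup>2 / 2 - \<phi> x) * (bump n (\<xi> $ 2) * bump n (\<xi> $ 3))))"
    proof (rule set_lebesgue_integral_cong)
      show "\<forall>x. x \<in> {0<..} \<longrightarrow> \<zeta>' x * g x = (LINT \<xi>|lebesgue. f x \<xi> *
        ((\<xi> $ 1 * \<zeta>' x * a (\<xi> $ 1) + p x * \<zeta> x * a' (\<xi> $ 1))
      * k ((\<xi> $ 1)\<^sup>2 / 2 - \<phi> x) * (bump n (\<xi> $ 2) * bump n (\<xi> $ 3))))"
      proof (intro allI impI)
        fix x :: real assume "x \<in> {0<..}"
        then have "a' t * k (t\<^sup>2 / 2 - \<phi> x) = 0" for t
          by (intro step(2) E_le) auto
        then have "(t * \<zeta>' x * a t + p x * \<zeta> x * a' t) * k (t\<^sup>2 / 2 - \<phi> x)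
            = \<zeta>' x * (t * a t * k (t\<^sup>2 / 2 - \<phi> x))" for t
          by (auto simp: distrib_right mult.assoc)
        then show "\<zeta>' x * g x = (LINT \<xi>|lebesgue. f x \<xi> *
          ((\<xi> $ 1 * \<zeta>' x * a (\<xi> $ 1) + p x * \<zeta> x * a' (\<xi> $ 1))
          * k ((\<xi> $ 1)\<^sup>2 / 2 - \<phi> x) * (bump n (\<xi> $ 2) * bump n (\<xi> $ 3))))"
          unfolding g_def N_def by (simp only: mult.assoc mult.left_commute[of "f x _"] Bochner_Integration.integral_mult_right_zero)
      qed
    qed simp
    also have "\<dots> = 0"
      by (rule product_test(3)[OF \<zeta> \<zeta>'_cont a_deriv a'_cont k C1_bump[OF n] b_supp supp bdry])
    finally show "(LINT x:{0<..}|lebesgue. (tent \<rho> (x - x1) - tent \<rho> (x - x2)) * g x) = 0"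
      by (simp only: \<zeta>'_def)
  qed
  have "(\<lambda>i. g (real i)) \<longlonglongrightarrow> (LINT \<xi>|lebesgue. f_inf \<xi> * N_inf \<xi>)"
    unfolding g_def
  proof (rule slice_integral_tendsto[OF N_cont N_inf_meas B])
    fix \<xi> :: "real ^ 3"
    have lim: "((\<lambda>x. k ((\<xi> $ 1)\<^sup>2 / 2 - \<phi> x)) \<longlongrightarrow> k ((\<xi> $ 1)\<^sup>2 / 2 - 0)) at_top"
      by (rule continuous_on_tendsto_compose[OF k_cont]) (intro tendsto_diff tendsto_const phi_lim, simp_all)
    show "((\<lambda>x. N x \<xi>) \<longlongrightarrow> N_inf \<xi>) at_top"
      unfolding N_def N_inf_def by (intro tendsto_mult tendsto_const lim[unfolded diff_zero])
  qed
  moreover have "\<forall>\<^sub>F i in sequentially. g (real i) = g x0"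
    using eventually_gt_at_top[of 0] by eventually_elim (intro const x0, simp)
  ultimately have "(LINT \<xi>|lebesgue. f_inf \<xi> * N_inf \<xi>) = g x0"
    by (intro LIMSEQ_unique[OF _ tendsto_eventually])
  then show "(LINT \<xi>|lebesgue. f x0 \<xi> * M x0 \<xi>) = (LINT \<xi>|lebesgue. f_inf \<xi> * M_inf \<xi>)"
    using x0 by (simp add: g_def N_M N_M_inf)
  show "integrable lebesgue (\<lambda>\<xi>. f x0 \<xi> * M x0 \<xi>)"
    using slice_integrable[OF _ slice_measurable[OF N_cont] B, of x0 x0] x0 by (simp add: N_M)
qed

end

lemma bump_mono: "0 < n \<Longrightarrow> n \<le> n' \<Longrightarrow> bump n t \<le> bump n' t"
  unfolding bump_def power_divide
  by (intro pos_sq_mono diff_mono order_refl divide_left_mono power_mono mult_pos_pos zero_less_power) auto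

lemma bump_tendsto_1: "(\<lambda>i. bump (real (Suc i)) t) \<longlonglongrightarrow> 1"
proof -
  have "(\<lambda>i. t / real (Suc i)) \<longlonglongrightarrow> 0"
    using LIMSEQ_inverse_real_of_nat tendsto_mult_right[OF LIMSEQ_inverse_real_of_nat, of t]
    by (simp add: divide_inverse mult.commute)
  then have "(\<lambda>i. (max 0 (1 - (t / real (Suc i))\<^sup>2))\<^sup>2) \<longlonglongrightarrow> (max 0 (1 - 0\<^sup>2))\<^sup>2"
    by (intro tendsto_intros)
  then show ?thesis
    by (simp add: bump_def pos_sq_def)
qed

text \<open>A \<open>C\<^sup>1\<close> cut-off from 0 for \<open>E \<le> 1 / n\<close> to 1 for \<open>E \<ge> 2 / n\<close>. Being increasing in \<open>n\<close>, like
  \<open>bump\<close>, it allows the cut-offs to be removed by monotone convergence, which yields integrability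
  of the limit as well.\<close>
definition low_cut :: "real \<Rightarrow> real \<Rightarrow> real" where
  "low_cut n E = 1 - pos_sq (1 - pos_sq (n * E - 1))"

lemma C1_low_cut: "low_cut n C1_differentiable_on UNIV"
proof -
  have lin: "(\<lambda>E. n * E - 1) C1_differentiable_on UNIV" "(\<lambda>E. 1 - E) C1_differentiable_on (UNIV :: real set)"
    by (rule C1_UNIV_I[of _ "\<lambda>_. n"] C1_UNIV_I[of _ "\<lambda>_. - 1"];
        auto intro!: derivative_eq_intros continuous_intros)+
  show ?thesis
    unfolding low_cut_def[abs_def]
    by (intro C1_UNIV_compose[OF lin(2)] C1_UNIV_compose[OF C1_pos_sq] lin(1))
qed

lemma low_cut_nonneg: "low_cut n E \<ge> 0"
  unfolding low_cut_def pos_sq_def using zero_le_power2 by (simp add: power_le_one)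

lemma low_cut_le_1: "low_cut n E \<le> 1"
  by (simp add: low_cut_def pos_sq_nonneg)

lemma low_cut_eq_0: "n > 0 \<Longrightarrow> E \<le> 1 / n \<Longrightarrow> low_cut n E = 0"
  by (simp add: low_cut_def pos_sq_def field_simps)

lemma low_cut_mono: "n \<le> n' \<Longrightarrow> 0 \<le> E \<Longrightarrow> low_cut n E \<le> low_cut n' E"
  unfolding low_cut_def by (intro diff_mono order_refl pos_sq_mono mult_right_mono)

lemma low_cut_tendsto_1:
  assumes "E > 0"
  shows "(\<lambda>i. low_cut (real (Suc i)) E) \<longlonglongrightarrow> 1"
proof (rule tendsto_eventually)
  obtain N :: nat where "2 / E < real N"
    using reals_Archimedean2 by blast
  then have N: "2 \<le> real N * E"
    using assms by (simp add: field_simps)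
  show "\<forall>\<^sub>F i in sequentially. low_cut (real (Suc i)) E = 1"
    using eventually_ge_at_top[of N]
  proof eventually_elim
    case (elim i)
    then have "real N * E \<le> real (Suc i) * E"
      using assms by (intro mult_right_mono) auto
    then have "real (Suc i) * E - 1 \<ge> 1"
      using N by linarith
    then have "pos_sq (real (Suc i) * E - 1) \<ge> 1"
      by (auto simp: pos_sq_def)
    then show ?case
      by (simp add: low_cut_def pos_sq_eq_0_iff)
  qed
qed

lemma C1_extend_by_zero:
  fixes h w :: "real \<Rightarrow> real"
  assumes h: "h C1_differentiable_on UNIV" and h0: "\<And>E. E \<le> c \<Longrightarrow> h E = 0" and c: "c > 0"
    and w: "w C1_differentiable_on {0<..}"
  shows "(\<lambda>E. if E > 0 then h E * w E else 0) C1_differentiable_on UNIV"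
proof -
  obtain h' where h': "\<And>t. (h has_real_derivative h' t) (at t)" "continuous_on UNIV h'"
    "continuous_on UNIV h"
    using C1_UNIV_D[OF h] by metis
  obtain w' where w': "\<And>t. t > 0 \<Longrightarrow> (w has_real_derivative w' t) (at t)" "continuous_on {0<..} w'"
    using w unfolding C1_differentiable_on_def has_real_derivative_iff_has_vector_derivative[symmetric]
    by (auto simp: greaterThan_iff)
  have w_cont: "continuous_on {0<..} w"
    using w'(1) by (intro continuous_at_imp_continuous_on) (auto intro: DERIV_isCont)
  have h'0: "h' E = 0" if "E < c" for E
  proof -
    have "(h has_real_derivative 0) (at E)"
      by (rule has_field_derivative_transform_within_open[of "\<lambda>_. 0" _ _ "{..<c}"])
        (use h0 that in auto)
    then show ?thesis
      using DERIV_unique h'(1) by blast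
  qed
  let ?d = "\<lambda>E. if E > 0 then h' E * w E + w' E * h E else 0"
  show ?thesis
  proof (rule C1_UNIV_I)
    fix E :: real
    show "((\<lambda>E. if E > 0 then h E * w E else 0) has_real_derivative ?d E) (at E)"
    proof (cases "E > 0")
      case True
      have "((\<lambda>E. h E * w E) has_real_derivative h' E * w E + w' E * h E) (at E)"
        by (rule DERIV_mult[OF h'(1) w'(1)[OF True]])
      then have "((\<lambda>E. if E > 0 then h E * w E else 0) has_real_derivative h' E * w E + w' E * h E) (at E)"
        by (rule has_field_derivative_transform_within_open[of _ _ _ "{0<..}"]) (use True in auto)
      then show ?thesis using True by simp
    next
      case False
      have "((\<lambda>E. if E > 0 then h E * w E else 0) has_real_derivative 0) (at E)"
        by (rule has_field_derivative_transform_within_open[of "\<lambda>_. 0" _ _ "{..<c}"])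
          (use h0 False c in auto)
      then show ?thesis using False by simp
    qed
    have "continuous_on ({0<..} \<union> {..<c}) ?d"
    proof (rule continuous_on_open_Un)
      have "continuous_on {0<..} (\<lambda>E. h' E * w E + w' E * h E)"
        by (intro continuous_intros w_cont w' continuous_on_subset[OF h'(2)]
            continuous_on_subset[OF h'(3)]) auto
      then show "continuous_on {0<..} ?d"
        by (rule continuous_on_eq) auto
      show "continuous_on {..<c} ?d"
        by (rule continuous_on_eq[OF continuous_on_const[of _ 0]]) (use h0 h'0 in auto)
    qed auto
    moreover have "{0<..} \<union> {..<c} = UNIV"
      using c by auto
    ultimately show "continuous_on UNIV ?d" by simp
  qed
qed

context vlasov_sheath
begin

text \<open>\<open>conserved_pairing\<close> for \<open>k = w\<close> without cut-offs. On the side of \<open>f x0\<close> nothing is known about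
  integrability against \<open>\<xi>\<^sub>1\<close>, so the cut-offs increase to 1 and monotone convergence applies; on the
  side of \<open>f_inf\<close> the limit is dominated.\<close>
lemma weighted_pairing:
  assumes s: "s = 1 \<or> s = (- 1 :: real)" and w: "w C1_differentiable_on {0<..}"
    and w_nonneg: "\<And>E. E > 0 \<Longrightarrow> w E \<ge> 0" and x0: "x0 > 0"
    and int: "integrable lebesgue (\<lambda>\<xi>. f_inf \<xi> * (\<bar>\<xi> $ 1\<bar> * of_bool (s * \<xi> $ 1 > 0) * w ((\<xi> $ 1)\<^sup>2 / 2)))"
  shows "integrable lebesgue (\<lambda>\<xi>. f x0 \<xi> * (\<bar>\<xi> $ 1\<bar> *
      of_bool (s * \<xi> $ 1 > 0 \<and> (\<xi> $ 1)\<^sup>2 / 2 > \<phi> x0) * w ((\<xi> $ 1)\<^sup>2 / 2 - \<phi> x0)))" (is "integrable _ ?u")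
    and "(LINT \<xi>|lebesgue. f x0 \<xi> * (\<bar>\<xi> $ 1\<bar> *
      of_bool (s * \<xi> $ 1 > 0 \<and> (\<xi> $ 1)\<^sup>2 / 2 > \<phi> x0) * w ((\<xi> $ 1)\<^sup>2 / 2 - \<phi> x0)))
      = (LINT \<xi>|lebesgue. f_inf \<xi> * (\<bar>\<xi> $ 1\<bar> * of_bool (s * \<xi> $ 1 > 0) * w ((\<xi> $ 1)\<^sup>2 / 2)))"
proof -
  define cut where "cut i E \<xi> = (low_cut (real (Suc i)) E * bump (real (Suc i)) E)
      * (bump (real (Suc i)) (\<xi> $ 2) * bump (real (Suc i)) (\<xi> $ 3))" for i E and \<xi> :: "real ^ 3"
  have cut_nonneg: "cut i E \<xi> \<ge> 0" for i E \<xi>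
    by (simp add: cut_def bump_nonneg low_cut_nonneg)
  have cut_le_1: "cut i E \<xi> \<le> 1" for i E \<xi>
  proof -
    have "cut i E \<xi> \<le> (1 * 1) * (1 * 1)"
      unfolding cut_def
      by (intro mult_mono low_cut_le_1 bump_le_1 mult_nonneg_nonneg bump_nonneg low_cut_nonneg zero_le_one)
    then show ?thesis by simp
  qed
  have cut_mono: "cut i E \<xi> \<le> cut j E \<xi>" if "i \<le> j" "E > 0" for i j E \<xi>
    unfolding cut_def using that
    by (intro mult_mono low_cut_mono bump_mono mult_nonneg_nonneg bump_nonneg low_cut_nonneg) auto
  have cut_lim: "(\<lambda>i. cut i E \<xi>) \<longlonglongrightarrow> 1" if "E > 0" for E \<xi>
  proof -
    have "(\<lambda>i. cut i E \<xi>) \<longlonglongrightarrow> (1 * 1) * (1 * 1)"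
      unfolding cut_def by (intro tendsto_mult bump_tendsto_1 low_cut_tendsto_1 that)
    then show ?thesis by simp
  qed
  define k where "k i E = (if E > 0 then low_cut (real (Suc i)) E * bump (real (Suc i)) E * w E else 0)"
    for i E
  have k_C1: "k i C1_differentiable_on UNIV" for i
  proof -
    obtain l' where l': "\<And>t. (low_cut (real (Suc i)) has_real_derivative l' t) (at t)" "continuous_on UNIV l'"
      "continuous_on UNIV (low_cut (real (Suc i)))"
      using C1_UNIV_D[OF C1_low_cut] by metis
    obtain b' where b': "\<And>t. (bump (real (Suc i)) has_real_derivative b' t) (at t)" "continuous_on UNIV b'"
      "continuous_on UNIV (bump (real (Suc i)))"
      using C1_UNIV_D[OF C1_bump] by (metis of_nat_0_less_iff zero_less_Suc)
    have "(\<lambda>E. low_cut (real (Suc i)) E * bump (real (Suc i)) E) C1_differentiable_on UNIV"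
      by (rule C1_UNIV_I[OF DERIV_mult[OF l'(1) b'(1)]]) (intro continuous_intros l' b')
    then show ?thesis
      unfolding k_def[abs_def]
      by (rule C1_extend_by_zero[where c = "1 / real (Suc i)"]) (use w in \<open>simp_all add: low_cut_eq_0\<close>)
  qed
  have k_low: "k i E = 0" if "E \<le> 1 / real (Suc i)" for i E
    using low_cut_eq_0[of "real (Suc i)" E] that by (simp add: k_def)
  have k_high: "k i E = 0" if "E \<ge> real (Suc i)" for i E
    using bump_eq_0_iff[of "real (Suc i)" E] that by (simp add: k_def)
  have low_high: "1 / real (Suc i) > 0" "1 / real (Suc i) \<le> real (Suc i)" for i
    by (simp, rule order_trans[of _ 1]) (simp_all add: divide_le_eq)
  have s_abs: "F * (\<bar>t\<bar> * of_bool (s * t > 0) * e * b) = s * (F * (t * of_bool (s * t > 0) * e * b))"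
    for F t e b
    using s by (auto simp: abs_if)
  define v where "v i \<xi> = f x0 \<xi> * (\<bar>\<xi> $ 1\<bar> * of_bool (s * \<xi> $ 1 > 0) * k i ((\<xi> $ 1)\<^sup>2 / 2 - \<phi> x0)
      * (bump (real (Suc i)) (\<xi> $ 2) * bump (real (Suc i)) (\<xi> $ 3)))" for i \<xi>
  define v_inf where "v_inf i \<xi> = f_inf \<xi> * (\<bar>\<xi> $ 1\<bar> * of_bool (s * \<xi> $ 1 > 0) * k i ((\<xi> $ 1)\<^sup>2 / 2)
      * (bump (real (Suc i)) (\<xi> $ 2) * bump (real (Suc i)) (\<xi> $ 3)))" for i \<xi>
  have pos: "real (Suc i) > 0" for i
    by simp
  have v_int: "integrable lebesgue (v i)" for i
    unfolding v_def[abs_def] s_abs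
    by (rule integrable_mult_right[OF conserved_pairing(1)[OF s k_C1[of i] k_low k_high low_high
            pos[of i] x0]])
  have v_eq: "integral\<^sup>L lebesgue (v i) = integral\<^sup>L lebesgue (v_inf i)" for i
    unfolding v_def[abs_def] v_inf_def[abs_def] s_abs Bochner_Integration.integral_mult_right_zero
    by (rule arg_cong[OF conserved_pairing(2)[OF s k_C1[of i] k_low k_high low_high pos[of i] x0]])
  have v_u: "v i \<xi> = ?u \<xi> * cut i ((\<xi> $ 1)\<^sup>2 / 2 - \<phi> x0) \<xi>" for i \<xi>
    by (simp add: v_def k_def cut_def)
  have v_inf_h: "v_inf i \<xi> = f_inf \<xi> * (\<bar>\<xi> $ 1\<bar> * of_bool (s * \<xi> $ 1 > 0) * w ((\<xi> $ 1)\<^sup>2 / 2))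
      * cut i ((\<xi> $ 1)\<^sup>2 / 2) \<xi>" for i \<xi>
    by (simp add: v_inf_def k_def cut_def)
  have cut_meas: "(\<lambda>\<xi>. cut i ((\<xi> $ 1)\<^sup>2 / 2) \<xi>) \<in> borel_measurable lebesgue" for i
  proof -
    have "continuous_on UNIV (\<lambda>\<xi>. cut i ((\<xi> $ 1)\<^sup>2 / 2) \<xi>)"
      unfolding cut_def low_cut_def bump_def by (intro continuous_intros) simp_all
    then show ?thesis
      by (auto intro!: measurable_completion borel_measurable_continuous_onI)
  qed
  have lim: "(\<lambda>i. integral\<^sup>L lebesgue (v i))
    \<longlonglongrightarrow> (LINT \<xi>|lebesgue. f_inf \<xi> * (\<bar>\<xi> $ 1\<bar> * of_bool (s * \<xi> $ 1 > 0) * w ((\<xi> $ 1)\<^sup>2 / 2)))"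
    unfolding v_eq
  proof (rule integral_dominated_convergence)
    show "AE \<xi> in lebesgue. norm (v_inf i \<xi>)
        \<le> \<bar>f_inf \<xi> * (\<bar>\<xi> $ 1\<bar> * of_bool (s * \<xi> $ 1 > 0) * w ((\<xi> $ 1)\<^sup>2 / 2))\<bar>" for i
      unfolding v_inf_h real_norm_def abs_mult[of "_ * _" "cut _ _ _"]
      using cut_nonneg cut_le_1 by (intro AE_I2 mult_left_le) (auto simp: abs_of_nonneg)
    show "AE \<xi> in lebesgue. (\<lambda>i. v_inf i \<xi>)
        \<longlonglongrightarrow> f_inf \<xi> * (\<bar>\<xi> $ 1\<bar> * of_bool (s * \<xi> $ 1 > 0) * w ((\<xi> $ 1)\<^sup>2 / 2))"
    proof (intro AE_I2)
      fix \<xi> :: "real ^ 3"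
      show "(\<lambda>i. v_inf i \<xi>)
        \<longlonglongrightarrow> f_inf \<xi> * (\<bar>\<xi> $ 1\<bar> * of_bool (s * \<xi> $ 1 > 0) * w ((\<xi> $ 1)\<^sup>2 / 2))"
        unfolding v_inf_h
        using tendsto_mult_left[OF cut_lim[of "(\<xi> $ 1)\<^sup>2 / 2" \<xi>]] by (cases "\<xi> $ 1 = 0") simp_all
    qed
    show "v_inf i \<in> borel_measurable lebesgue" for i
      unfolding v_inf_h[abs_def]
      by (rule borel_measurable_times[OF borel_measurable_integrable[OF int] cut_meas])
  qed (use int in auto)
  have v_mono: "AE \<xi> in lebesgue. mono (\<lambda>i. v i \<xi>)"
    using f_nonneg[OF less_imp_le[OF x0]]
  proof eventually_elim
    case (elim \<xi>)
    show ?case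
    proof (rule monoI)
      fix i j :: nat assume "i \<le> j"
      show "v i \<xi> \<le> v j \<xi>"
      proof (cases "(\<xi> $ 1)\<^sup>2 / 2 > \<phi> x0")
        case True
        then show ?thesis
          unfolding v_u using elim w_nonneg \<open>i \<le> j\<close>
          by (intro mult_left_mono cut_mono mult_nonneg_nonneg) simp_all
      next
        case False
        then show ?thesis by (simp add: v_u)
      qed
    qed
  qed
  have v_lim: "AE \<xi> in lebesgue. (\<lambda>i. v i \<xi>) \<longlonglongrightarrow> ?u \<xi>"
  proof (intro AE_I2)
    fix \<xi> :: "real ^ 3"
    show "(\<lambda>i. v i \<xi>) \<longlonglongrightarrow> ?u \<xi>"
    proof (cases "(\<xi> $ 1)\<^sup>2 / 2 > \<phi> x0")
      case True
      then have "(\<lambda>i. ?u \<xi> * cut i ((\<xi> $ 1)\<^sup>2 / 2 - \<phi> x0) \<xi>) \<longlonglongrightarrow> ?u \<xi> * 1"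
        by (intro tendsto_mult tendsto_const cut_lim) simp
      then show ?thesis by (simp only: v_u mult_1_right)
    next
      case False
      then show ?thesis by (simp add: v_u)
    qed
  qed
  have u_meas: "?u \<in> borel_measurable lebesgue"
  proof (rule borel_measurable_lebesgue_cong_AE)
    show "(\<lambda>\<xi>. lim (\<lambda>i. v i \<xi>)) \<in> borel_measurable lebesgue"
      by (rule borel_measurable_lim_metric[OF borel_measurable_integrable[OF v_int]])
    show "AE \<xi> in lebesgue. ?u \<xi> = lim (\<lambda>i. v i \<xi>)"
      using v_lim by eventually_elim (rule limI[symmetric])
  qed
  show "integrable lebesgue ?u"
    by (rule integrable_monotone_convergence[OF v_int v_mono v_lim lim u_meas])
  show "integral\<^sup>L lebesgue ?u
      = (LINT \<xi>|lebesgue. f_inf \<xi> * (\<bar>\<xi> $ 1\<bar> * of_bool (s * \<xi> $ 1 > 0) * w ((\<xi> $ 1)\<^sup>2 / 2)))"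
    by (rule integral_monotone_convergence[OF v_int v_mono v_lim lim u_meas])
qed

end

section \<open>Support and moments of the distribution function\<close>

lemma AE_component_neq: "AE \<xi> in lebesgue. (\<xi> :: real ^ 3) $ i \<noteq> a"
proof -
  have "negligible {\<xi> :: real ^ 3. \<xi> \<bullet> axis i 1 = a}"
    by (rule negligible_standard_hyperplane) (simp add: axis_in_Basis_iff)
  then have "{\<xi> :: real ^ 3. \<xi> $ i = a} \<in> null_sets lebesgue"
    by (simp add: negligible_iff_null_sets cart_eq_inner_axis)
  then show ?thesis
    by (simp add: completion.AE_iff_null_sets)
qed

context vlasov_sheath
begin

text \<open>Countably many cut-offs exhaust the trapped region with \<open>\<xi>\<^sub>1 \<noteq> 0\<close>.\<close>
lemma trapped_vanish:
  assumes x: "x > 0"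
  shows "AE \<xi> in lebesgue. (\<xi> $ 1)\<^sup>2 / 2 < \<phi> x \<longrightarrow> f x \<xi> = 0"
proof -
  have "AE \<xi> in lebesgue. \<forall>i. f x \<xi> * (\<xi> $ 1 * pos_sq (- ((\<xi> $ 1)\<^sup>2 / 2 - \<phi> x) - 1 / real (Suc i))
      * (bump (real (Suc i)) (\<xi> $ 2) * bump (real (Suc i)) (\<xi> $ 3))) = 0"
    unfolding AE_all_countable by (intro allI trapped_cutoff_vanish x) simp_all
  then show ?thesis
    using AE_component_neq[of 1 0]
  proof eventually_elim
    case (elim \<xi>)
    show ?case
    proof
      assume E: "(\<xi> $ 1)\<^sup>2 / 2 < \<phi> x"
      define e where "e = \<phi> x - (\<xi> $ 1)\<^sup>2 / 2"
      have e: "e > 0"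
        using E by (simp add: e_def)
      obtain i :: nat where "max (1 / e) (max \<bar>\<xi> $ 2\<bar> \<bar>\<xi> $ 3\<bar>) < real i"
        using reals_Archimedean2 by blast
      then have i: "1 / e < real (Suc i)" "\<bar>\<xi> $ 2\<bar> < real (Suc i)" "\<bar>\<xi> $ 3\<bar> < real (Suc i)"
        by simp_all
      have "1 / real (Suc i) < e"
        using i(1) e by (simp add: field_simps)
      then have "pos_sq (- ((\<xi> $ 1)\<^sup>2 / 2 - \<phi> x) - 1 / real (Suc i)) > 0"
        unfolding pos_sq_pos_iff e_def by linarith
      moreover have "bump (real (Suc i)) (\<xi> $ 2) > 0" "bump (real (Suc i)) (\<xi> $ 3) > 0"
        using i by (simp_all add: bump_pos_iff)
      ultimately show "f x \<xi> = 0"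
        using elim(1)[rule_format, of i] elim(2) by simp
    qed
  qed
qed

text \<open>The rightward flux is conserved and vanishes at infinity, and it is the integral of a
  nonnegative function.\<close>
lemma rightward_vanish:
  assumes x: "x > 0" and leftward: "\<forall>\<xi>. \<xi> $ 1 \<ge> 0 \<longrightarrow> f_inf \<xi> = 0"
  shows "AE \<xi> in lebesgue. \<xi> $ 1 > 0 \<and> (\<xi> $ 1)\<^sup>2 / 2 > \<phi> x \<longrightarrow> f x \<xi> = 0"
proof -
  have zero: "f_inf \<xi> * (\<bar>\<xi> $ 1\<bar> * of_bool (1 * \<xi> $ 1 > 0) * 1) = 0" for \<xi>
    using leftward[rule_format, of \<xi>] by (cases "\<xi> $ 1 > 0") simp_all
  have w: "(\<lambda>_. 1 :: real) C1_differentiable_on {0<..}"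
    by simp
  have pair: "integrable lebesgue (\<lambda>\<xi>. f x \<xi> * (\<bar>\<xi> $ 1\<bar> *
      of_bool (1 * \<xi> $ 1 > 0 \<and> (\<xi> $ 1)\<^sup>2 / 2 > \<phi> x) * 1))"
    "(LINT \<xi>|lebesgue. f x \<xi> * (\<bar>\<xi> $ 1\<bar> *
      of_bool (1 * \<xi> $ 1 > 0 \<and> (\<xi> $ 1)\<^sup>2 / 2 > \<phi> x) * 1)) = 0"
    using weighted_pairing[where s = 1 and w = "\<lambda>_. 1", OF _ w _ x] unfolding zero by simp_all
  have "AE \<xi> in lebesgue. f x \<xi> * (\<bar>\<xi> $ 1\<bar> *
      of_bool (1 * \<xi> $ 1 > 0 \<and> (\<xi> $ 1)\<^sup>2 / 2 > \<phi> x) * 1) = 0"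
    using f_nonneg[OF less_imp_le[OF x]] pair(2)
    by (subst (asm) integral_nonneg_eq_0_iff_AE[OF pair(1)]) auto
  then show ?thesis
    by eventually_elim auto
qed

lemma support_leftward:
  assumes x: "x > 0" and leftward: "\<forall>\<xi>. \<xi> $ 1 \<ge> 0 \<longrightarrow> f_inf \<xi> = 0"
  shows "AE \<xi> in lebesgue. f x \<xi> \<noteq> 0 \<longrightarrow> \<xi> $ 1 < 0 \<and> (\<xi> $ 1)\<^sup>2 / 2 > \<phi> x"
  using trapped_vanish[OF x] rightward_vanish[OF x leftward]
    AE_component_neq[of 1 "sqrt (2 * \<phi> x)"] AE_component_neq[of 1 "- sqrt (2 * \<phi> x)"]
proof eventually_elim
  case (elim \<xi>)
  have "(\<xi> $ 1)\<^sup>2 / 2 \<noteq> \<phi> x"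
  proof
    assume "(\<xi> $ 1)\<^sup>2 / 2 = \<phi> x"
    then have "sqrt (2 * \<phi> x) = \<bar>\<xi> $ 1\<bar>"
      by (metis nonzero_mult_div_cancel_left real_sqrt_abs times_divide_eq_right zero_neq_numeral)
    then show False
      using elim(3,4) by (auto simp: abs_if split: if_splits)
  qed
  then consider "(\<xi> $ 1)\<^sup>2 / 2 < \<phi> x" | "(\<xi> $ 1)\<^sup>2 / 2 > \<phi> x" by linarith
  then show ?case
  proof cases
    case 2
    then have "\<xi> $ 1 \<noteq> 0"
      using phi_pos[of x] x by auto
    then show ?thesis
      using 2 elim(2) by linarith
  qed (use elim in auto)
qed

lemma momentum_flux:
  assumes x: "x > 0" and leftward: "\<forall>\<xi>. \<xi> $ 1 \<ge> 0 \<longrightarrow> f_inf \<xi> = 0"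
    and int: "integrable lebesgue (\<lambda>\<xi>. \<xi> $ 1 * f_inf \<xi>)"
  shows "(LINT \<xi>|lebesgue. \<xi> $ 1 * f x \<xi>) = (LINT \<xi>|lebesgue. \<xi> $ 1 * f_inf \<xi>)"
proof -
  have w: "(\<lambda>_. 1 :: real) C1_differentiable_on {0<..}"
    by simp
  have eq: "f_inf \<xi> * (\<bar>\<xi> $ 1\<bar> * of_bool (- 1 * \<xi> $ 1 > 0) * 1) = - (\<xi> $ 1 * f_inf \<xi>)" for \<xi>
    using leftward[rule_format, of \<xi>] by (cases "\<xi> $ 1 < 0") simp_all
  let ?u = "\<lambda>\<xi>. f x \<xi> * (\<bar>\<xi> $ 1\<bar> * of_bool (- 1 * \<xi> $ 1 > 0 \<and> (\<xi> $ 1)\<^sup>2 / 2 > \<phi> x) * 1)"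
  have pair: "integrable lebesgue ?u" "integral\<^sup>L lebesgue ?u = - (LINT \<xi>|lebesgue. \<xi> $ 1 * f_inf \<xi>)"
    using weighted_pairing[where s = "- 1" and w = "\<lambda>_. 1", OF _ w _ x] int unfolding eq by simp_all
  have ae: "AE \<xi> in lebesgue. \<xi> $ 1 * f x \<xi> = - ?u \<xi>"
    using support_leftward[OF x leftward] by eventually_elim auto
  have u: "(\<lambda>\<xi>. - ?u \<xi>) \<in> borel_measurable lebesgue"
    using pair(1) by (intro borel_measurable_uminus borel_measurable_integrable)
  have "(LINT \<xi>|lebesgue. \<xi> $ 1 * f x \<xi>) = (LINT \<xi>|lebesgue. - ?u \<xi>)"
    by (rule integral_cong_AE[OF borel_measurable_lebesgue_cong_AE[OF u ae] u ae])
  also have "\<dots> = (LINT \<xi>|lebesgue. \<xi> $ 1 * f_inf \<xi>)"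
    using pair(2) by (simp only: Bochner_Integration.integral_minus minus_minus)
  finally show ?thesis .
qed

text \<open>A particle at \<open>x\<close> with energy \<open>E\<close> has \<open>\<bar>\<xi>\<^sub>1\<bar> = sqrt (2 E + 2 \<phi> x)\<close>. Dividing the conserved flux by this function
  of the energy, for one fixed \<open>x\<close>, turns it into the density at \<open>x\<close>.\<close>
lemma density_formula:
  assumes x: "x > 0" and leftward: "\<forall>\<xi>. \<xi> $ 1 \<ge> 0 \<longrightarrow> f_inf \<xi> = 0"
  shows "particle_density f x = (LINT \<xi>|lebesgue. f_inf \<xi> * (\<bar>\<xi> $ 1\<bar> / sqrt ((\<xi> $ 1)\<^sup>2 + 2 * \<phi> x)))"
proof -
  define w where "w E = 1 / sqrt (2 * E + 2 * \<phi> x)" for E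
  have phi: "\<phi> x > 0"
    using phi_pos x by simp
  have w: "w C1_differentiable_on {0<..}"
    unfolding C1_differentiable_on_def has_real_derivative_iff_has_vector_derivative[symmetric]
  proof (intro exI conjI ballI)
    let ?D = "\<lambda>E. - 1 / (sqrt (2 * E + 2 * \<phi> x) * (2 * E + 2 * \<phi> x))"
    show "(w has_real_derivative ?D E) (at E)" if "E \<in> {0<..}" for E
    proof -
      have pos: "2 * E + 2 * \<phi> x > 0"
        using that phi by simp
      then have "sqrt (2 * E + 2 * \<phi> x) * sqrt (2 * E + 2 * \<phi> x) = 2 * E + 2 * \<phi> x"
        by simp
      then show ?thesis
        unfolding w_def[abs_def] using pos
        by (auto intro!: derivative_eq_intros simp: divide_simps)
    qed
    show "continuous_on {0<..} ?D"
      by (intro continuous_intros) (use phi in auto)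
  qed
  have w_nonneg: "w E \<ge> 0" if "E > 0" for E
    using that phi by (simp add: w_def)
  have eq: "f_inf \<xi> * (\<bar>\<xi> $ 1\<bar> * of_bool (- 1 * \<xi> $ 1 > 0) * w ((\<xi> $ 1)\<^sup>2 / 2))
      = f_inf \<xi> * (\<bar>\<xi> $ 1\<bar> / sqrt ((\<xi> $ 1)\<^sup>2 + 2 * \<phi> x))" for \<xi>
    using leftward[rule_format, of \<xi>] by (cases "\<xi> $ 1 < 0") (simp_all add: w_def)
  have "\<bar>\<bar>\<xi> $ 1\<bar> / sqrt ((\<xi> $ 1)\<^sup>2 + 2 * \<phi> x)\<bar> \<le> 1" for \<xi> :: "real ^ 3"
  proof -
    have "sqrt ((\<xi> $ 1)\<^sup>2) \<le> sqrt ((\<xi> $ 1)\<^sup>2 + 2 * \<phi> x)"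
      using phi by (intro real_sqrt_le_mono) simp
    then show ?thesis
      using phi by (simp add: divide_le_eq_1 add_nonneg_pos)
  qed
  moreover have "(\<lambda>\<xi> :: real ^ 3. \<bar>\<xi> $ 1\<bar> / sqrt ((\<xi> $ 1)\<^sup>2 + 2 * \<phi> x)) \<in> borel_measurable lebesgue"
  proof -
    have "(\<xi> $ 1)\<^sup>2 + 2 * \<phi> x \<noteq> 0" for \<xi> :: "real ^ 3"
      using phi zero_le_power2[of "\<xi> $ 1"] by linarith
    then have "continuous_on UNIV (\<lambda>\<xi> :: real ^ 3. \<bar>\<xi> $ 1\<bar> / sqrt ((\<xi> $ 1)\<^sup>2 + 2 * \<phi> x))"
      by (intro continuous_intros) simp_all
    then show ?thesis
      by (auto intro!: measurable_completion borel_measurable_continuous_onI)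
  qed
  ultimately have int: "integrable lebesgue (\<lambda>\<xi>. f_inf \<xi> * (\<bar>\<xi> $ 1\<bar> / sqrt ((\<xi> $ 1)\<^sup>2 + 2 * \<phi> x)))"
    using f_inf_int
    by (intro Bochner_Integration.integrable_bound[OF f_inf_int])
      (auto simp only: real_norm_def abs_mult intro!: AE_I2 mult_left_le borel_measurable_times abs_ge_zero)
  let ?u = "\<lambda>\<xi>. f x \<xi> * (\<bar>\<xi> $ 1\<bar> * of_bool (- 1 * \<xi> $ 1 > 0 \<and> (\<xi> $ 1)\<^sup>2 / 2 > \<phi> x)
      * w ((\<xi> $ 1)\<^sup>2 / 2 - \<phi> x))"
  have pair: "integrable lebesgue ?u"
    "integral\<^sup>L lebesgue ?u = (LINT \<xi>|lebesgue. f_inf \<xi> * (\<bar>\<xi> $ 1\<bar> / sqrt ((\<xi> $ 1)\<^sup>2 + 2 * \<phi> x)))"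
    using weighted_pairing[where s = "- 1", OF _ w w_nonneg x] int unfolding eq by simp_all
  have ae: "AE \<xi> in lebesgue. f x \<xi> = ?u \<xi>"
    using support_leftward[OF x leftward]
  proof eventually_elim
    case (elim \<xi>)
    show ?case
    proof (cases "f x \<xi> = 0")
      case False
      then have "\<xi> $ 1 < 0" "(\<xi> $ 1)\<^sup>2 / 2 > \<phi> x"
        using elim by auto
      moreover have "w ((\<xi> $ 1)\<^sup>2 / 2 - \<phi> x) = 1 / \<bar>\<xi> $ 1\<bar>"
        by (simp add: w_def)
      ultimately show ?thesis by simp
    qed simp
  qed
  have "particle_density f x = integral\<^sup>L lebesgue ?u"
    unfolding particle_density_def
    by (rule integral_cong_AE[OF borel_measurable_integrable[OF f_int] borel_measurable_integrable[OF pair(1)] ae])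
      (use x in simp)
  then show ?thesis
    using pair(2) by simp
qed

end

section \<open>Comparison of the two potentials\<close>

text \<open>Values above \<open>\<eta>\<close> would be attained at an interior maximum, where convexity makes \<open>d\<close> increase to the
  right.\<close>
lemma second_derivative_maximum_principle:
  fixes d d1 d2 :: "real \<Rightarrow> real"
  assumes cont: "continuous_on half_line d" and d0: "d 0 \<le> \<eta>" and lim: "(d \<longlongrightarrow> l) at_top" "l \<le> \<eta>"
    and d1: "\<And>x. x > 0 \<Longrightarrow> (d has_real_derivative d1 x) (at x)"
    and d2: "\<And>x. x > 0 \<Longrightarrow> (d1 has_real_derivative d2 x) (at x)"
    and convex: "\<And>x. x > 0 \<Longrightarrow> d x > \<eta> \<Longrightarrow> d2 x > 0"
    and x: "x \<ge> 0"
  shows "d x \<le> \<eta>"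
proof (rule ccontr)
  assume "\<not> d x \<le> \<eta>"
  then have big: "d x > \<eta>" by simp
  then have "\<forall>\<^sub>F y in at_top. d y < d x"
    by (intro order_tendstoD(2)[OF lim(1)]) (use lim(2) in linarith)
  then obtain X where X: "\<And>y. y \<ge> X \<Longrightarrow> d y < d x"
    by (auto simp: eventually_at_top_linorder)
  have "x < X"
    using X[of x] by (meson less_irrefl not_le)
  obtain y where y: "y \<in> {0..X}" "\<And>z. z \<in> {0..X} \<Longrightarrow> d z \<le> d y"
    using continuous_attains_sup[of "{0..X}" d] continuous_on_subset[OF cont] \<open>x < X\<close> x
    by (metis atLeastAtMost_iff atLeastatMost_empty_iff2 compact_Icc atLeast_iff less_le_not_le order_trans subsetI)
  have ge: "d x \<le> d y"
    using y(2)[of x] x \<open>x < X\<close> by simp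
  have max: "d z \<le> d y" if "z \<ge> 0" for z
    using y(2)[of z] X[of z] ge that by (cases "z \<le> X") auto
  have "y \<noteq> 0"
    using ge big d0 by auto
  then have "y > 0"
    using y(1) by simp
  have "d1 y = 0"
    by (rule DERIV_local_max[OF d1[OF \<open>y > 0\<close>] \<open>y > 0\<close>]) (use max in auto)
  moreover obtain \<delta> where \<delta>: "\<delta> > 0" "\<And>h. h > 0 \<Longrightarrow> h < \<delta> \<Longrightarrow> d1 y < d1 (y + h)"
    using DERIV_pos_inc_right[OF d2[OF \<open>y > 0\<close>] convex[OF \<open>y > 0\<close>]] ge big by auto
  ultimately have pos: "d1 z > 0" if "y < z" "z < y + \<delta>" for z
    using \<delta>(2)[of "z - y"] that by simp
  have "d y < d (y + \<delta> / 2)"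
  proof (rule DERIV_pos_imp_increasing_open[of y "y + \<delta> / 2" d])
    show "\<exists>D. (d has_real_derivative D) (at z) \<and> D > 0" if "y < z" "z < y + \<delta> / 2" for z
      using d1[of z] pos[of z] that \<open>y > 0\<close> \<delta>(1) by auto
    show "continuous_on {y..y + \<delta> / 2} d"
      by (rule continuous_on_subset[OF cont]) (use \<open>y > 0\<close> in auto)
  qed (use \<delta> in auto)
  then show False
    using max[of "y + \<delta> / 2"] \<open>y > 0\<close> \<delta>(1) by simp
qed

lemma zero_derivative_eq_limit:
  fixes g :: "real \<Rightarrow> real"
  assumes g: "\<And>x. x > 0 \<Longrightarrow> (g has_real_derivative 0) (at x)" and lim: "(g \<longlongrightarrow> l) at_top" and x: "x > 0"
  shows "g x = l"
proof -
  obtain c where c: "\<And>y. y \<in> {0<..} \<Longrightarrow> g y = c"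
    using has_field_derivative_zero_constant[of "{0<..}" g] g
    by (metis convex_real_interval(3) greaterThan_iff has_field_derivative_at_within)
  have "(g \<longlongrightarrow> c) at_top"
    by (rule tendsto_eventually, rule eventually_at_top_linorderI[of 1]) (use c in simp)
  then have "c = l"
    using lim by (intro tendsto_unique) auto
  then show ?thesis
    using c x by simp
qed

text \<open>The density of a beam of velocity \<open>v\<close> and density 1 at infinity after acceleration by the potential \<open>s\<close>.\<close>
definition fluid_density :: "real \<Rightarrow> real \<Rightarrow> real" where
  "fluid_density v s = v / sqrt (v\<^sup>2 + 2 * s)"

lemma fluid_density_diff_velocity:
  assumes s: "s \<ge> 0" and v: "v \<ge> 1" "v' \<ge> 1"
  shows "\<bar>fluid_density v s - fluid_density v' s\<bar> \<le> 2 * s * \<bar>v - v'\<bar>"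
proof -
  define r where "r t = sqrt (t\<^sup>2 + 2 * s)" for t
  have r: "r t \<ge> 1" "r t * r t = t\<^sup>2 + 2 * s" if "t \<ge> 1" for t
  proof -
    have "1 \<le> t\<^sup>2 + 2 * s"
      using one_le_power[OF that, of 2] s by linarith
    then show "r t \<ge> 1" "r t * r t = t\<^sup>2 + 2 * s"
      by (simp_all add: r_def)
  qed
  have "norm (fluid_density v s - fluid_density v' s) \<le> (2 * s) * norm (v - v')"
  proof (rule field_differentiable_bound[where S = "{1..}" and f = "\<lambda>t. fluid_density t s"])
    fix t :: real assume "t \<in> {1..}"
    then have t: "t \<ge> 1" by simp
    have pos: "t\<^sup>2 + 2 * s > 0"
      using t s by (simp add: add_pos_nonneg)
    have "((\<lambda>t. t\<^sup>2 + 2 * s) has_real_derivative 2 * t) (at t)"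
      by (auto intro!: derivative_eq_intros)
    then have "(r has_real_derivative inverse (r t) / 2 * (2 * t)) (at t)"
      unfolding r_def[abs_def] by (rule DERIV_chain2[of sqrt _ "\<lambda>t. t\<^sup>2 + 2 * s", OF DERIV_real_sqrt[OF pos]])
    then have "((\<lambda>t. t / r t) has_real_derivative (1 * r t - t * (inverse (r t) / 2 * (2 * t))) / (r t * r t)) (at t)"
      by (rule DERIV_divide[OF DERIV_ident]) (use r(1)[OF t] in auto)
    moreover have "(1 * r t - t * (inverse (r t) / 2 * (2 * t))) / (r t * r t) = 2 * s / (r t * r t * r t)"
      using r[OF t] by (simp add: divide_simps power2_eq_square)
    ultimately show "((\<lambda>t. fluid_density t s) has_real_derivative 2 * s / (r t * r t * r t)) (at t within {1..})"
      unfolding fluid_density_def r_def[symmetric] by (simp only: has_field_derivative_at_within)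
    have "1 * 1 * 1 \<le> r t * r t * r t"
      using r(1)[OF t] by (intro mult_mono) auto
    then show "norm (2 * s / (r t * r t * r t)) \<le> 2 * s"
      using s by (simp add: divide_le_eq mult_le_cancel_left1)
  qed (use v in auto)
  then show ?thesis by simp
qed

lemma fluid_density_diff_potential:
  assumes v: "v > 0" and s: "s \<ge> 0" "s' \<ge> 0"
  shows "\<bar>fluid_density v s - fluid_density v s'\<bar> \<le> \<bar>s - s'\<bar> / v\<^sup>2"
proof -
  define r where "r t = sqrt (v\<^sup>2 + 2 * t)" for t
  have r: "r t \<ge> v" if "t \<ge> 0" for t
    using that v real_sqrt_le_mono[of "v\<^sup>2" "v\<^sup>2 + 2 * t"] by (simp add: r_def)
  have "norm (fluid_density v s - fluid_density v s') \<le> (1 / v\<^sup>2) * norm (s - s')"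
  proof (rule field_differentiable_bound[where S = "{0..}" and f = "\<lambda>t. fluid_density v t"])
    fix t :: real assume "t \<in> {0..}"
    then have t: "t \<ge> 0" by simp
    have pos: "v\<^sup>2 + 2 * t > 0"
      using t v by (simp add: add_pos_nonneg)
    have "((\<lambda>t. v\<^sup>2 + 2 * t) has_real_derivative 2) (at t)"
      by (auto intro!: derivative_eq_intros)
    then have "(r has_real_derivative inverse (r t) / 2 * 2) (at t)"
      unfolding r_def[abs_def] by (rule DERIV_chain2[of sqrt _ "\<lambda>t. v\<^sup>2 + 2 * t", OF DERIV_real_sqrt[OF pos]])
    then have "((\<lambda>t. v / r t) has_real_derivative (0 * r t - v * (inverse (r t) / 2 * 2)) / (r t * r t)) (at t)"
      by (rule DERIV_divide[OF DERIV_const]) (use r[OF t] v in auto)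
    moreover have "(0 * r t - v * (inverse (r t) / 2 * 2)) / (r t * r t) = - v / (r t * r t * r t)"
      using r[OF t] v by (simp add: divide_simps)
    ultimately show "(fluid_density v has_real_derivative - v / (r t * r t * r t)) (at t within {0..})"
      unfolding fluid_density_def[abs_def] r_def[symmetric] by (simp only: has_field_derivative_at_within)
    have "v * v * v \<le> r t * r t * r t"
      using r[OF t] v by (intro mult_mono) auto
    then have "v / (r t * r t * r t) \<le> v / (v * v * v)"
      using v by (intro divide_left_mono mult_pos_pos) (use r[OF t] in auto)
    also have "\<dots> = 1 / v\<^sup>2"
      using v by (simp add: power2_eq_square)
    finally show "norm (- v / (r t * r t * r t)) \<le> 1 / v\<^sup>2"
      using r[OF t] v by simp
  qed (use s in auto)
  then show ?thesis by simp
qed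

lemma exp_minus_diff_ge:
  fixes a b :: real
  assumes "b \<le> a" "a \<le> \<delta>" "\<delta> \<le> 1"
  shows "(1 - \<delta>) * (a - b) \<le> exp (- b) - exp (- a)"
proof -
  have "1 - \<delta> \<le> exp (- a)"
    using exp_ge_add_one_self[of "- a"] assms by linarith
  moreover have "a - b \<le> exp (a - b) - 1"
    using exp_ge_add_one_self[of "a - b"] by linarith
  ultimately have "(1 - \<delta>) * (a - b) \<le> exp (- a) * (exp (a - b) - 1)"
    using assms by (intro mult_mono) auto
  also have "\<dots> = exp (- b) - exp (- a)"
    by (simp add: right_diff_distrib flip: exp_add)
  finally show ?thesis .
qed

text \<open>At \<open>s = 0\<close> the charge density \<open>fluid_density v s - exp (- s)\<close> has slope \<open>1 - 1 / v\<^sup>2\<close>, positive exactly in the supersonic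
  range (the Bohm criterion). Half of this slope survives for \<open>s\<close> up to the stated bound.\<close>
lemma charge_increasing:
  assumes v: "v > 1" and ab: "0 \<le> b" "b \<le> a" "a \<le> (1 - 1 / v\<^sup>2) / 2"
  shows "(1 - 1 / v\<^sup>2) / 2 * (a - b)
    \<le> (fluid_density v a - exp (- a)) - (fluid_density v b - exp (- b))"
proof -
  define k where "k = 1 / v\<^sup>2"
  have k: "k > 0" "a \<le> (1 - k) / 2"
    using v ab(3) by (simp_all add: k_def)
  have "(1 - (1 - k) / 2) * (a - b) \<le> exp (- b) - exp (- a)"
    by (rule exp_minus_diff_ge) (use ab k in auto)
  moreover have "fluid_density v b - fluid_density v a \<le> (a - b) * k"
    using fluid_density_diff_potential[of v b a] v ab by (simp add: k_def)
  moreover have "(1 - (1 - k) / 2) * (a - b) - (a - b) * k = (1 - k) / 2 * (a - b)"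
    by (simp add: field_simps)
  ultimately show ?thesis
    unfolding k_def[symmetric] by linarith
qed

section \<open>The approximate delta functions\<close>

lemma approx_delta_nonneg: "mollifier \<eta> \<Longrightarrow> 0 < \<epsilon> \<Longrightarrow> approx_delta \<eta> v \<epsilon> \<xi> \<ge> 0"
  by (simp add: approx_delta_def mollifier_def)

lemma approx_delta_support:
  assumes "mollifier \<eta>" "0 < \<epsilon>" "approx_delta \<eta> v \<epsilon> \<xi> \<noteq> 0"
  shows "\<bar>\<xi> $ 1 + v\<bar> < \<epsilon>"
proof -
  have "\<eta> ((\<xi> - vector [- v, 0, 0]) /\<^sub>R \<epsilon>) \<noteq> 0"
    using assms by (simp add: approx_delta_def)
  then have "(\<xi> - vector [- v, 0, 0]) /\<^sub>R \<epsilon> \<in> ball 0 1"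
    using assms(1) closure_subset[of "{\<xi>. \<eta> \<xi> \<noteq> 0}"] unfolding mollifier_def by fast
  then have "norm (\<xi> - vector [- v, 0, 0]) < \<epsilon>"
    using assms(2) by (simp only: mem_ball_0 norm_scaleR) (simp add: inverse_eq_divide)
  moreover have "\<bar>(\<xi> - vector [- v, 0, 0]) $ 1\<bar> \<le> norm (\<xi> - vector [- v, 0, 0])"
    by (rule component_le_norm_cart)
  ultimately show ?thesis by simp
qed

lemma integral_approx_delta:
  assumes \<eta>: "mollifier \<eta>" and \<epsilon>: "0 < \<epsilon>"
  shows "(LINT \<xi>|lebesgue. approx_delta \<eta> v \<epsilon> \<xi>) = 1"
proof -
  have "times_differentiable 0 \<eta>"
    using \<eta> by (simp add: mollifier_def smooth_def)
  then have meas: "\<eta> \<in> borel_measurable borel"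
    by (simp add: borel_measurable_continuous_onI)
  let ?T = "\<lambda>\<xi> :: real ^ 3. vector [- v, 0, 0] + \<epsilon> *\<^sub>R \<xi>"
  have meas': "approx_delta \<eta> v \<epsilon> \<in> borel_measurable borel"
    unfolding approx_delta_def[abs_def] using meas by measurable
  have "(LINT \<xi>|lebesgue. approx_delta \<eta> v \<epsilon> \<xi>) = (LINT \<xi>|lborel. approx_delta \<eta> v \<epsilon> \<xi>)"
    by (rule integral_completion) (use meas' in simp)
  also have "\<dots> = (LINT \<xi>|density (distr lborel borel ?T) (\<lambda>_. \<bar>\<epsilon>\<bar> ^ DIM(real ^ 3)). approx_delta \<eta> v \<epsilon> \<xi>)"
    using \<epsilon> by (subst lborel_affine[of \<epsilon> "vector [- v, 0, 0]"]) simp_all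
  also have "\<dots> = (LINT \<xi>|lborel. \<epsilon> ^ 3 * approx_delta \<eta> v \<epsilon> (?T \<xi>))"
    using \<epsilon> meas' by (subst integral_density) (auto simp: integral_distr)
  also have "\<dots> = (LINT \<xi>|lborel. \<eta> \<xi>)"
    using \<epsilon> by (simp add: approx_delta_def)
  also have "\<dots> = (LINT \<xi>|lebesgue. \<eta> \<xi>)"
    by (rule integral_completion[symmetric]) (use meas in simp)
  finally show ?thesis
    using \<eta> by (simp add: mollifier_def)
qed

section \<open>The two problems as equations for the potential\<close>

text \<open>The mass flux \<open>\<rho> u\<close> and the energy \<open>u\<^sup>2 / 2 - \<phi>\<close> are constant, hence equal to their limits, and positivity of
  \<open>\<rho>\<close> selects the negative root for \<open>u\<close>. Of the two monotone alternatives only a decreasing \<open>\<phi>\<close> is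
  compatible with \<open>\<phi>\<^sub>b > 0\<close> and limit 0.\<close>
lemma EP_monotone_solution_formulas:
  assumes v: "v > 0" and EP: "EP_monotone_solution v \<phi>\<^sub>b \<rho> u \<phi>" and \<phi>\<^sub>b: "\<phi>\<^sub>b > 0"
  obtains p q where
    "\<And>x. x \<ge> 0 \<Longrightarrow> (\<phi> has_real_derivative p x) (at x within half_line)"
    "\<And>x. x > 0 \<Longrightarrow> (p has_real_derivative q x) (at x)"
    "\<And>x. x > 0 \<Longrightarrow> q x = fluid_density v (\<phi> x) - exp (- \<phi> x)"
    "\<And>x. x \<ge> 0 \<Longrightarrow> 0 \<le> \<phi> x" "\<And>x. x \<ge> 0 \<Longrightarrow> \<phi> x \<le> \<phi>\<^sub>b" "\<phi> 0 = \<phi>\<^sub>b" "(\<phi> \<longlongrightarrow> 0) at_top"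
    "\<And>x. x > 0 \<Longrightarrow> \<rho> x * u x = - v" "\<And>x. x > 0 \<Longrightarrow> \<rho> x = fluid_density v (\<phi> x)"
proof -
  have smooth: "smooth_half_line \<rho>" "smooth_half_line u" "smooth_half_line \<phi>"
    and mono: "monotone_half_line \<phi>" and \<phi>0: "\<phi> 0 = \<phi>\<^sub>b"
    and inf: "(INF x\<in>{0<..}. ereal (\<rho> x)) > 0"
    and lim: "((\<lambda>x. (\<rho> x, u x, \<phi> x)) \<longlongrightarrow> (1, - v, 0)) at_top"
    and ode: "\<And>x. x > 0 \<Longrightarrow> deriv (\<lambda>y. \<rho> y * u y) x = 0" "\<And>x. x > 0 \<Longrightarrow> u x * deriv u x = deriv \<phi> x"
      "\<And>x. x > 0 \<Longrightarrow> deriv (deriv \<phi>) x = \<rho> x - exp (- \<phi> x)"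
    using EP by (simp_all add: EP_monotone_solution_def)
  have lims: "(\<rho> \<longlongrightarrow> 1) at_top" "(u \<longlongrightarrow> - v) at_top" "(\<phi> \<longlongrightarrow> 0) at_top"
    using tendsto_fst[OF lim] tendsto_fst[OF tendsto_snd[OF lim]] tendsto_snd[OF tendsto_snd[OF lim]] by simp_all
  have at: "at x within half_line = at x" if "x > 0" for x :: real
    using that by (simp add: at_within_interior[of x half_line])
  obtain R where R: "\<And>x. x > 0 \<Longrightarrow> (\<rho> has_real_derivative R x) (at x)"
    using smooth(1) at unfolding smooth_half_line_def by (metis less_imp_le)
  obtain U where U: "\<And>x. x > 0 \<Longrightarrow> (u has_real_derivative U x) (at x)"
    using smooth(2) at unfolding smooth_half_line_def by (metis less_imp_le)
  obtain D where D: "D 0 = \<phi>" "\<And>n x. x \<ge> 0 \<Longrightarrow> (D n has_real_derivative D (Suc n) x) (at x within half_line)"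
    using smooth(3) unfolding smooth_half_line_def by metis
  have D': "(D n has_real_derivative D (Suc n) x) (at x)" if "x > 0" for n x
    using D(2)[of x n] at[OF that] that by simp
  have \<phi>': "(\<phi> has_real_derivative D 1 x) (at x)" if "x > 0" for x
    using D'[OF that, of 0] D(1) by simp
  have flux: "\<rho> x * u x = - v" if x: "x > 0" for x
  proof (rule zero_derivative_eq_limit[OF _ _ x])
    show "((\<lambda>x. \<rho> x * u x) \<longlongrightarrow> - v) at_top"
      using tendsto_mult[OF lims(1,2)] by simp
    fix y :: real assume y: "y > 0"
    have "((\<lambda>y. \<rho> y * u y) has_real_derivative R y * u y + U y * \<rho> y) (at y)"
      by (rule DERIV_mult[OF R[OF y] U[OF y]])
    then show "((\<lambda>y. \<rho> y * u y) has_real_derivative 0) (at y)"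
      using ode(1)[OF y] DERIV_imp_deriv by fastforce
  qed
  have bernoulli: "(u x)\<^sup>2 - 2 * \<phi> x = v\<^sup>2" if x: "x > 0" for x
  proof (rule zero_derivative_eq_limit[OF _ _ x])
    show "((\<lambda>x. (u x)\<^sup>2 - 2 * \<phi> x) \<longlongrightarrow> v\<^sup>2) at_top"
      using tendsto_diff[OF tendsto_power[OF lims(2), of 2] tendsto_mult_left[OF lims(3), of 2]] by simp
    fix y :: real assume y: "y > 0"
    have "U y * u y = D 1 y"
      using ode(2)[OF y] DERIV_imp_deriv[OF U[OF y]] DERIV_imp_deriv[OF \<phi>'[OF y]] by (simp add: mult.commute)
    then show "((\<lambda>y. (u y)\<^sup>2 - 2 * \<phi> y) has_real_derivative 0) (at y)"
      by (auto intro!: derivative_eq_intros U[OF y] \<phi>'[OF y])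
  qed
  have "\<not> mono_on half_line \<phi>"
  proof
    assume m: "mono_on half_line \<phi>"
    have "\<phi>\<^sub>b \<le> 0"
    proof (rule tendsto_lowerbound[OF lims(3)])
      show "\<forall>\<^sub>F x in at_top. \<phi>\<^sub>b \<le> \<phi> x"
        by (rule eventually_at_top_linorderI[of 0]) (use m \<phi>0 in \<open>auto simp: monotone_on_def\<close>)
    qed simp
    then show False using \<phi>\<^sub>b by simp
  qed
  then have anti: "antimono_on half_line \<phi>"
    using mono by (simp add: monotone_half_line_def)
  have le: "\<phi> x \<le> \<phi>\<^sub>b" if "x \<ge> 0" for x
    using anti that \<phi>0 by (force simp: monotone_on_def)
  have nonneg: "0 \<le> \<phi> x" if "x \<ge> 0" for x
  proof (rule tendsto_upperbound[OF lims(3)])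
    show "\<forall>\<^sub>F y in at_top. \<phi> y \<le> \<phi> x"
      by (rule eventually_at_top_linorderI[of x]) (use anti that in \<open>auto simp: monotone_on_def\<close>)
  qed simp
  have \<rho>: "\<rho> x = fluid_density v (\<phi> x)" if x: "x > 0" for x
  proof -
    have "0 < ereal (\<rho> x)"
      by (rule less_le_trans[OF inf INF_lower]) (use x in simp)
    then have pos: "\<rho> x > 0" by simp
    have eq: "\<rho> x * - u x = v"
      using flux[OF x] by simp
    then have "- u x > 0"
      using pos v by (metis zero_less_mult_pos)
    moreover have "(- u x)\<^sup>2 = v\<^sup>2 + 2 * \<phi> x"
      using bernoulli[OF x] by simp
    ultimately have "sqrt (v\<^sup>2 + 2 * \<phi> x) = - u x"
      by (intro real_sqrt_unique) auto
    then show ?thesis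
      using eq \<open>- u x > 0\<close> by (simp add: fluid_density_def field_simps)
  qed
  show thesis
  proof (rule that[of "D 1" "D 2"])
    show "(\<phi> has_real_derivative D 1 x) (at x within half_line)" if "x \<ge> 0" for x
      using D(2)[OF that, of 0] D(1) by simp
    show "(D 1 has_real_derivative D 2 x) (at x)" if "x > 0" for x
      using D'[OF that, of 1] by (simp add: numeral_2_eq_2)
    show "D 2 x = fluid_density v (\<phi> x) - exp (- \<phi> x)" if x: "x > 0" for x
    proof -
      have "(deriv \<phi> has_real_derivative D 2 x) (at x)"
        using D'[OF x, of 1] unfolding numeral_2_eq_2 One_nat_def
        by (rule has_field_derivative_transform_within_open[of _ _ _ "{0<..}"])
          (use x DERIV_imp_deriv[OF \<phi>'] in auto)
      then show ?thesis
        using ode(3)[OF x] \<rho>[OF x] DERIV_imp_deriv by fastforce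
    qed
  qed (use le nonneg \<phi>0 lims flux \<rho> in auto)
qed

text \<open>All particles at infinity have \<open>\<bar>\<xi>\<^sub>1 + v\<bar> < \<epsilon>\<close>, and \<open>\<epsilon> < (v - 1) / 2\<close> keeps their speed above 1. The moments of
  \<open>f\<close> are averages over these velocities of functions that are close to their value at \<open>- v\<close>. The exclusion of
  zero density reflects the division in \<open>mean_velocity\<close>.\<close>
lemma VP_solution_moments:
  assumes v: "v > 1" and \<eta>: "mollifier \<eta>" and \<epsilon>: "0 < \<epsilon>" "\<epsilon> < (v - 1) / 2"
    and VP: "VP_solution 0 \<phi>\<^sub>b (\<lambda>_. 0) (approx_delta \<eta> v \<epsilon>) (\<lambda>s. exp (- s)) f \<phi>" and \<phi>\<^sub>b: "\<phi>\<^sub>b > 0"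
  obtains p q where
    "\<And>x. x \<ge> 0 \<Longrightarrow> (\<phi> has_real_derivative p x) (at x within half_line)"
    "\<And>x. x > 0 \<Longrightarrow> (p has_real_derivative q x) (at x)"
    "\<And>x. x > 0 \<Longrightarrow> q x = particle_density f x - exp (- \<phi> x)"
    "\<And>x. x \<ge> 0 \<Longrightarrow> 0 \<le> \<phi> x" "\<And>x. x \<ge> 0 \<Longrightarrow> \<phi> x \<le> \<phi>\<^sub>b" "\<phi> 0 = \<phi>\<^sub>b" "(\<phi> \<longlongrightarrow> 0) at_top"
    "\<And>x. x > 0 \<Longrightarrow> \<bar>particle_density f x - fluid_density v (\<phi> x)\<bar> \<le> 2 * \<epsilon> * \<phi> x"
    "\<And>x. x > 0 \<Longrightarrow> particle_density f x \<noteq> 0 \<Longrightarrow> \<bar>particle_density f x * mean_velocity f x + v\<bar> \<le> \<epsilon>"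
proof -
  let ?d = "approx_delta \<eta> v \<epsilon>"
  obtain p q where
    loc: "L1_loc f" "C_L1 f" and
    \<phi>': "\<forall>x\<ge>0. (\<phi> has_real_derivative p x) (at x within half_line)" and p_cont: "continuous_on half_line p" and
    p': "\<forall>x>0. (p has_real_derivative q x) (at x)" and
    f_nonneg: "\<forall>x\<ge>0. AE \<xi> in lebesgue. f x \<xi> \<ge> 0" and
    sign: "(\<forall>x\<ge>0. p x > 0) \<or> (\<forall>x\<ge>0. p x < 0)" and
    weak: "\<forall>\<psi>. VP_test 0 \<psi> \<longrightarrow>
        (LINT z:({0<..} \<times> UNIV)|lebesgue.
           f (fst z) (snd z) * (snd z $ 1 * d_x \<psi> z + p (fst z) * d_xi1 \<psi> z)) = 0" and
    d_int: "integrable lebesgue ?d" and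
    f_lim: "((\<lambda>x. LINT \<xi>|lebesgue. \<bar>f x \<xi> - ?d \<xi>\<bar>) \<longlongrightarrow> 0) at_top" and
    poisson: "\<forall>x>0. q x = (LINT \<xi>|lebesgue. f x \<xi>) - exp (- \<phi> x)" and
    \<phi>0: "\<phi> 0 = \<phi>\<^sub>b" and \<phi>_lim: "(\<phi> \<longlongrightarrow> 0) at_top"
    using VP unfolding VP_solution_def by auto
  have "\<not> (\<forall>x\<ge>0. p x > 0)"
  proof
    assume pos: "\<forall>x\<ge>0. p x > 0"
    have "\<phi>\<^sub>b \<le> \<phi> x" if "x \<ge> 0" for x
    proof -
      have "\<phi> 0 \<le> \<phi> x"
      proof (rule DERIV_nonneg_imp_increasing_open[OF that])
        show "continuous_on {0..x} \<phi>"
          by (rule continuous_on_subset[OF DERIV_continuous_on[of half_line \<phi> p]]) (use \<phi>' in auto)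
        fix t assume "0 < t" "t < x"
        then have "(\<phi> has_real_derivative p t) (at t)"
          using \<phi>'[rule_format, of t] by (simp add: at_within_interior[of t half_line])
        then show "\<exists>D. (\<phi> has_real_derivative D) (at t) \<and> 0 \<le> D"
          using pos \<open>0 < t\<close> by (meson less_imp_le)
      qed
      then show ?thesis using \<phi>0 by simp
    qed
    then have "\<phi>\<^sub>b \<le> 0"
      by (intro tendsto_lowerbound[OF \<phi>_lim] eventually_at_top_linorderI[of 0]) auto
    then show False using \<phi>\<^sub>b by simp
  qed
  then have p_neg: "\<forall>x\<ge>0. p x < 0"
    using sign by blast
  interpret vlasov_sheath f \<phi> p ?d
    by unfold_locales (use loc \<phi>' p_cont p_neg f_nonneg weak d_int f_lim \<phi>_lim in blast)+
  note d_nonneg = approx_delta_nonneg[OF \<eta> \<epsilon>(1), of v]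
  have d_supp: "\<bar>\<xi> $ 1 + v\<bar> < \<epsilon>" "\<xi> $ 1 < - 1" if "?d \<xi> \<noteq> 0" for \<xi>
    using approx_delta_support[OF \<eta> \<epsilon>(1) that] \<epsilon> v by (auto simp: abs_less_iff)
  have leftward: "\<forall>\<xi>. \<xi> $ 1 \<ge> 0 \<longrightarrow> ?d \<xi> = 0"
    using d_supp(2) by force
  have mass: "integral\<^sup>L lebesgue ?d = 1"
    by (rule integral_approx_delta[OF \<eta> \<epsilon>(1)])
  have coord: "(\<lambda>\<xi> :: real ^ 3. \<xi> $ 1) \<in> borel_measurable lebesgue"
    by (intro measurable_completion) simp
  \<comment> \<open>A kernel within \<open>B\<close> of a constant \<open>c\<close> on the support averages to within \<open>B\<close> of \<open>c\<close>.\<close>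
  have average: "\<bar>(LINT \<xi>|lebesgue. ?d \<xi> * g \<xi>) - c\<bar> \<le> B" "integrable lebesgue (\<lambda>\<xi>. ?d \<xi> * g \<xi>)"
    if g: "g \<in> borel_measurable lebesgue" and B: "\<And>\<xi>. ?d \<xi> \<noteq> 0 \<Longrightarrow> \<bar>g \<xi> - c\<bar> \<le> B" for g c B
  proof -
    have bound: "\<bar>?d \<xi> * (g \<xi> - c)\<bar> \<le> B * ?d \<xi>" for \<xi>
      using B[of \<xi>] d_nonneg[of \<xi>] by (cases "?d \<xi> = 0") (auto simp: abs_mult mult.commute)
    have int: "integrable lebesgue (\<lambda>\<xi>. ?d \<xi> * (g \<xi> - c))"
      by (rule Bochner_Integration.integrable_bound[OF integrable_mult_right[OF d_int, of B]])
        (use g d_int bound in \<open>auto intro!: order_trans[OF bound abs_ge_self]\<close>)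
    have split: "?d \<xi> * g \<xi> = ?d \<xi> * (g \<xi> - c) + c * ?d \<xi>" for \<xi>
      by (simp add: algebra_simps)
    show "integrable lebesgue (\<lambda>\<xi>. ?d \<xi> * g \<xi>)"
      unfolding split by (intro Bochner_Integration.integrable_add int integrable_mult_right d_int)
    have "(LINT \<xi>|lebesgue. ?d \<xi> * g \<xi>) - c = (LINT \<xi>|lebesgue. ?d \<xi> * (g \<xi> - c))"
      unfolding split using int d_int mass by (simp add: Bochner_Integration.integral_add)
    also have "\<bar>\<dots>\<bar> \<le> (LINT \<xi>|lebesgue. B * ?d \<xi>)"
      by (rule order_trans[OF integral_abs_bound integral_mono]) (use int d_int bound in auto)
    also have "\<dots> = B"
      using mass by simp
    finally show "\<bar>(LINT \<xi>|lebesgue. ?d \<xi> * g \<xi>) - c\<bar> \<le> B" .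
  qed
  show thesis
  proof (rule that[of p q])
    fix x :: real assume x: "x > 0"
    have \<phi>x: "\<phi> x > 0"
      using phi_pos x by simp
    have meas: "(\<lambda>\<xi> :: real ^ 3. \<bar>\<xi> $ 1\<bar> / sqrt ((\<xi> $ 1)\<^sup>2 + 2 * \<phi> x)) \<in> borel_measurable lebesgue"
      using coord by measurable
    show "\<bar>particle_density f x - fluid_density v (\<phi> x)\<bar> \<le> 2 * \<epsilon> * \<phi> x"
      unfolding density_formula[OF x leftward]
    proof (rule average(1)[OF meas])
      fix \<xi> assume d: "?d \<xi> \<noteq> 0"
      have "\<bar>fluid_density \<bar>\<xi> $ 1\<bar> (\<phi> x) - fluid_density v (\<phi> x)\<bar> \<le> 2 * \<phi> x * \<bar>\<bar>\<xi> $ 1\<bar> - v\<bar>"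
        using d_supp(2)[OF d] v \<phi>x by (intro fluid_density_diff_velocity) auto
      also have "\<dots> \<le> 2 * \<phi> x * \<epsilon>"
        using d_supp[OF d] \<phi>x by (intro mult_left_mono) auto
      finally show "\<bar>\<bar>\<xi> $ 1\<bar> / sqrt ((\<xi> $ 1)\<^sup>2 + 2 * \<phi> x) - fluid_density v (\<phi> x)\<bar> \<le> 2 * \<epsilon> * \<phi> x"
        by (simp add: fluid_density_def mult.commute mult.left_commute)
    qed
    have near: "\<bar>\<xi> $ 1 - (- v)\<bar> \<le> \<epsilon>" if "?d \<xi> \<noteq> 0" for \<xi>
      using d_supp(1)[OF that] by simp
    have "(LINT \<xi>|lebesgue. \<xi> $ 1 * f x \<xi>) = (LINT \<xi>|lebesgue. \<xi> $ 1 * ?d \<xi>)"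
      by (rule momentum_flux[OF x leftward]) (use average(2)[OF coord near] in \<open>simp add: mult.commute\<close>)
    then have "\<bar>(LINT \<xi>|lebesgue. \<xi> $ 1 * f x \<xi>) + v\<bar> \<le> \<epsilon>"
      using average(1)[OF coord near] by (simp add: mult.commute)
    then show "\<bar>particle_density f x * mean_velocity f x + v\<bar> \<le> \<epsilon>" if "particle_density f x \<noteq> 0"
      using that by (simp add: mean_velocity_def)
  qed (use \<phi>' p' poisson phi_pos phi_le \<phi>0 \<phi>_lim in \<open>auto simp: particle_density_def less_imp_le\<close>)
qed

theorem theorem2p4:
  fixes u_inf :: real and \<eta> :: "real ^ 3 \<Rightarrow> real"
  assumes "u_inf > 1" and "mollifier \<eta>"
  shows "\<exists>\<delta>\<^sub>0>0. \<exists>C\<^sub>0>0. \<forall>\<phi>\<^sub>b. 0 < \<phi>\<^sub>b \<and> \<phi>\<^sub>b < \<delta>\<^sub>0 \<longrightarrow>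
    (\<forall>\<rho> u \<phi>. EP_monotone_solution u_inf \<phi>\<^sub>b \<rho> u \<phi> \<longrightarrow>
      (\<forall>\<epsilon> f\<^sub>\<epsilon> \<phi>\<^sub>\<epsilon>. 0 < \<epsilon> \<and> \<epsilon> < (u_inf - 1) / 2 \<and> \<epsilon> < 1 \<and>
         VP_solution 0 \<phi>\<^sub>b (\<lambda>_. 0) (approx_delta \<eta> u_inf \<epsilon>) (\<lambda>s. exp (- s)) f\<^sub>\<epsilon> \<phi>\<^sub>\<epsilon> \<longrightarrow>
         sup_dist (particle_density f\<^sub>\<epsilon>) \<rho> +
         sup_dist (\<lambda>x. particle_density f\<^sub>\<epsilon> x * mean_velocity f\<^sub>\<epsilon> x) (\<lambda>x. \<rho> x * u x) +
         sup_dist \<phi>\<^sub>\<epsilon> \<phi> \<le> ereal (C\<^sub>0 * \<epsilon>)))"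
proof -
  define c where "c = (1 - 1 / u_inf\<^sup>2) / 2"
  have "1 < u_inf\<^sup>2"
    using assms(1) by (simp add: one_less_power)
  then have "1 / u_inf\<^sup>2 < 1"
    by (subst divide_less_eq_1_pos) auto
  then have c: "c > 0"
    by (simp add: c_def)
  \<comment> \<open>Below \<open>c\<close> the charge increases with rate \<open>c\<close>; below \<open>1 / 4\<close> the kinetic density is positive.\<close>
  define \<delta>\<^sub>0 where "\<delta>\<^sub>0 = min c (1 / 4)"
  have main: "sup_dist (particle_density f\<^sub>\<epsilon>) \<rho> +
         sup_dist (\<lambda>x. particle_density f\<^sub>\<epsilon> x * mean_velocity f\<^sub>\<epsilon> x) (\<lambda>x. \<rho> x * u x) +
         sup_dist \<phi>\<^sub>\<epsilon> \<phi> \<le> ereal (7 * \<epsilon>)"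
    if \<phi>\<^sub>b: "0 < \<phi>\<^sub>b" "\<phi>\<^sub>b < \<delta>\<^sub>0" and EP: "EP_monotone_solution u_inf \<phi>\<^sub>b \<rho> u \<phi>"
      and \<epsilon>: "0 < \<epsilon>" "\<epsilon> < (u_inf - 1) / 2" "\<epsilon> < 1"
      and VP: "VP_solution 0 \<phi>\<^sub>b (\<lambda>_. 0) (approx_delta \<eta> u_inf \<epsilon>) (\<lambda>s. exp (- s)) f\<^sub>\<epsilon> \<phi>\<^sub>\<epsilon>"
    for \<phi>\<^sub>b \<rho> u \<phi> \<epsilon> f\<^sub>\<epsilon> \<phi>\<^sub>\<epsilon>
  proof -
    have v: "u_inf > 0"
      using assms(1) by simp
    obtain p q where e: "\<And>x. x \<ge> 0 \<Longrightarrow> (\<phi> has_real_derivative p x) (at x within half_line)"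
      "\<And>x. x > 0 \<Longrightarrow> (p has_real_derivative q x) (at x)"
      "\<And>x. x > 0 \<Longrightarrow> q x = fluid_density u_inf (\<phi> x) - exp (- \<phi> x)"
      "\<And>x. x \<ge> 0 \<Longrightarrow> 0 \<le> \<phi> x" "\<And>x. x \<ge> 0 \<Longrightarrow> \<phi> x \<le> \<phi>\<^sub>b" "\<phi> 0 = \<phi>\<^sub>b" "(\<phi> \<longlongrightarrow> 0) at_top"
      "\<And>x. x > 0 \<Longrightarrow> \<rho> x * u x = - u_inf" "\<And>x. x > 0 \<Longrightarrow> \<rho> x = fluid_density u_inf (\<phi> x)"
      by (rule EP_monotone_solution_formulas[OF v EP \<phi>\<^sub>b(1)]) blast
    obtain P Q where k: "\<And>x. x \<ge> 0 \<Longrightarrow> (\<phi>\<^sub>\<epsilon> has_real_derivative P x) (at x within half_line)"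
      "\<And>x. x > 0 \<Longrightarrow> (P has_real_derivative Q x) (at x)"
      "\<And>x. x > 0 \<Longrightarrow> Q x = particle_density f\<^sub>\<epsilon> x - exp (- \<phi>\<^sub>\<epsilon> x)"
      "\<And>x. x \<ge> 0 \<Longrightarrow> 0 \<le> \<phi>\<^sub>\<epsilon> x" "\<And>x. x \<ge> 0 \<Longrightarrow> \<phi>\<^sub>\<epsilon> x \<le> \<phi>\<^sub>b" "\<phi>\<^sub>\<epsilon> 0 = \<phi>\<^sub>b" "(\<phi>\<^sub>\<epsilon> \<longlongrightarrow> 0) at_top"
      "\<And>x. x > 0 \<Longrightarrow> \<bar>particle_density f\<^sub>\<epsilon> x - fluid_density u_inf (\<phi>\<^sub>\<epsilon> x)\<bar> \<le> 2 * \<epsilon> * \<phi>\<^sub>\<epsilon> x"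
      "\<And>x. x > 0 \<Longrightarrow> particle_density f\<^sub>\<epsilon> x \<noteq> 0 \<Longrightarrow>
        \<bar>particle_density f\<^sub>\<epsilon> x * mean_velocity f\<^sub>\<epsilon> x + u_inf\<bar> \<le> \<epsilon>"
      by (rule VP_solution_moments[OF assms \<epsilon>(1,2) VP \<phi>\<^sub>b(1)]) blast
    have at: "at x within half_line = at x" if "x > 0" for x :: real
      using that by (simp add: at_within_interior[of x half_line])
    have e': "(\<phi> has_real_derivative p x) (at x)" if "x > 0" for x
      using e(1)[of x] that by (simp add: at)
    have k': "(\<phi>\<^sub>\<epsilon> has_real_derivative P x) (at x)" if "x > 0" for x
      using k(1)[of x] that by (simp add: at)
    have cont: "continuous_on half_line \<phi>" "continuous_on half_line \<phi>\<^sub>\<epsilon>"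
      by (rule DERIV_continuous_on, rule e(1), simp) (rule DERIV_continuous_on, rule k(1), simp)
    have small: "\<phi> x \<le> c" "\<phi>\<^sub>\<epsilon> x \<le> c" "2 * \<epsilon> * \<phi>\<^sub>\<epsilon> x < c * (2 * \<epsilon>)" "\<phi>\<^sub>\<epsilon> x < 1 / 4" if "x \<ge> 0" for x
      using e(5)[OF that] k(5)[OF that] \<phi>\<^sub>b(2) \<epsilon>(1) by (auto simp: \<delta>\<^sub>0_def)
    have upper: "\<phi>\<^sub>\<epsilon> x - \<phi> x \<le> 2 * \<epsilon>" if "x \<ge> 0" for x
    proof (rule second_derivative_maximum_principle[where d = "\<lambda>x. \<phi>\<^sub>\<epsilon> x - \<phi> x" and l = 0, OF _ _ _ _ _ _ _ that])
      show "continuous_on half_line (\<lambda>x. \<phi>\<^sub>\<epsilon> x - \<phi> x)"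
        by (intro continuous_intros cont)
      show "((\<lambda>x. \<phi>\<^sub>\<epsilon> x - \<phi> x) \<longlongrightarrow> 0) at_top"
        using tendsto_diff[OF k(7) e(7)] by simp
      fix x :: real assume x: "x > 0"
      show "((\<lambda>x. \<phi>\<^sub>\<epsilon> x - \<phi> x) has_real_derivative P x - p x) (at x)"
        by (rule DERIV_diff[OF k'[OF x] e'[OF x]])
      show "((\<lambda>x. P x - p x) has_real_derivative Q x - q x) (at x)"
        by (rule DERIV_diff[OF k(2)[OF x] e(2)[OF x]])
      show "Q x - q x > 0" if gap: "\<phi>\<^sub>\<epsilon> x - \<phi> x > 2 * \<epsilon>"
      proof -
        have "c * (\<phi>\<^sub>\<epsilon> x - \<phi> x) \<le> (fluid_density u_inf (\<phi>\<^sub>\<epsilon> x) - exp (- \<phi>\<^sub>\<epsilon> x))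
            - (fluid_density u_inf (\<phi> x) - exp (- \<phi> x))"
          unfolding c_def
          by (rule charge_increasing[OF assms(1)])
            (use e(4)[of x] small[of x] gap x \<epsilon>(1) in \<open>simp_all add: c_def\<close>)
        moreover have "c * (2 * \<epsilon>) < c * (\<phi>\<^sub>\<epsilon> x - \<phi> x)"
          using gap c by simp
        ultimately show ?thesis
          using k(3,8)[OF x] e(3)[OF x] small(3)[of x] x by linarith
      qed
    qed (use e(6) k(6) \<epsilon>(1) in simp_all)
    have lower: "\<phi> x - \<phi>\<^sub>\<epsilon> x \<le> 2 * \<epsilon>" if "x \<ge> 0" for x
    proof (rule second_derivative_maximum_principle[where d = "\<lambda>x. \<phi> x - \<phi>\<^sub>\<epsilon> x" and l = 0, OF _ _ _ _ _ _ _ that])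
      show "continuous_on half_line (\<lambda>x. \<phi> x - \<phi>\<^sub>\<epsilon> x)"
        by (intro continuous_intros cont)
      show "((\<lambda>x. \<phi> x - \<phi>\<^sub>\<epsilon> x) \<longlongrightarrow> 0) at_top"
        using tendsto_diff[OF e(7) k(7)] by simp
      fix x :: real assume x: "x > 0"
      show "((\<lambda>x. \<phi> x - \<phi>\<^sub>\<epsilon> x) has_real_derivative p x - P x) (at x)"
        by (rule DERIV_diff[OF e'[OF x] k'[OF x]])
      show "((\<lambda>x. p x - P x) has_real_derivative q x - Q x) (at x)"
        by (rule DERIV_diff[OF e(2)[OF x] k(2)[OF x]])
      show "q x - Q x > 0" if gap: "\<phi> x - \<phi>\<^sub>\<epsilon> x > 2 * \<epsilon>"
      proof -
        have "c * (\<phi> x - \<phi>\<^sub>\<epsilon> x) \<le> (fluid_density u_inf (\<phi> x) - exp (- \<phi> x))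
            - (fluid_density u_inf (\<phi>\<^sub>\<epsilon> x) - exp (- \<phi>\<^sub>\<epsilon> x))"
          unfolding c_def
          by (rule charge_increasing[OF assms(1)])
            (use k(4)[of x] small[of x] gap x \<epsilon>(1) in \<open>simp_all add: c_def\<close>)
        moreover have "c * (2 * \<epsilon>) < c * (\<phi> x - \<phi>\<^sub>\<epsilon> x)"
          using gap c by simp
        ultimately show ?thesis
          using k(3,8)[OF x] e(3)[OF x] small(3)[of x] x by linarith
      qed
    qed (use e(6) k(6) \<epsilon>(1) in simp_all)
    have potential: "\<bar>\<phi>\<^sub>\<epsilon> x - \<phi> x\<bar> \<le> 2 * \<epsilon>" if "x > 0" for x
      using upper[of x] lower[of x] that by linarith
    have error: "2 * \<epsilon> * \<phi>\<^sub>\<epsilon> x \<le> 2 * \<epsilon>" "2 * \<epsilon> * \<phi>\<^sub>\<epsilon> x \<le> 1 / 2" if "x > 0" for x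
    proof -
      show "2 * \<epsilon> * \<phi>\<^sub>\<epsilon> x \<le> 2 * \<epsilon>"
        using small(4)[of x] that \<epsilon>(1) by simp
      have "\<epsilon> * \<phi>\<^sub>\<epsilon> x \<le> 1 * (1 / 4)"
        using small(4)[of x] k(4)[of x] that \<epsilon> by (intro mult_mono) auto
      then show "2 * \<epsilon> * \<phi>\<^sub>\<epsilon> x \<le> 1 / 2"
        by simp
    qed
    have lipschitz: "\<bar>fluid_density u_inf s - fluid_density u_inf s'\<bar> \<le> \<bar>s - s'\<bar>"
      if "s \<ge> 0" "s' \<ge> 0" for s s'
    proof -
      have "\<bar>s - s'\<bar> / u_inf\<^sup>2 \<le> \<bar>s - s'\<bar> / 1"
        using \<open>1 < u_inf\<^sup>2\<close> by (intro divide_left_mono) auto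
      then show ?thesis
        using fluid_density_diff_potential[OF v that] by simp
    qed
    have density: "\<bar>particle_density f\<^sub>\<epsilon> x - \<rho> x\<bar> \<le> 4 * \<epsilon>" if x: "x > 0" for x
      using lipschitz[of "\<phi>\<^sub>\<epsilon> x" "\<phi> x"] potential[OF x] k(8)[OF x] error(1)[OF x] e(4)[of x] k(4)[of x]
        e(9)[OF x] x by linarith
    have flux: "\<bar>particle_density f\<^sub>\<epsilon> x * mean_velocity f\<^sub>\<epsilon> x - \<rho> x * u x\<bar> \<le> \<epsilon>" if x: "x > 0" for x
    proof -
      have "fluid_density u_inf 0 = 1"
        using v by (simp add: fluid_density_def)
      then have "particle_density f\<^sub>\<epsilon> x > 0"
        using lipschitz[of "\<phi>\<^sub>\<epsilon> x" 0] k(4)[of x] k(8)[OF x] small(4)[of x] error(2)[OF x] x by linarith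
      then show ?thesis
        using k(9)[OF x] e(8)[OF x] by simp
    qed
    have "sup_dist (particle_density f\<^sub>\<epsilon>) \<rho> \<le> ereal (4 * \<epsilon>)"
      "sup_dist (\<lambda>x. particle_density f\<^sub>\<epsilon> x * mean_velocity f\<^sub>\<epsilon> x) (\<lambda>x. \<rho> x * u x) \<le> ereal \<epsilon>"
      "sup_dist \<phi>\<^sub>\<epsilon> \<phi> \<le> ereal (2 * \<epsilon>)"
      unfolding sup_dist_def using density flux potential by (auto intro!: SUP_least)
    then have "sup_dist (particle_density f\<^sub>\<epsilon>) \<rho> +
         sup_dist (\<lambda>x. particle_density f\<^sub>\<epsilon> x * mean_velocity f\<^sub>\<epsilon> x) (\<lambda>x. \<rho> x * u x) +
         sup_dist \<phi>\<^sub>\<epsilon> \<phi> \<le> ereal (4 * \<epsilon>) + ereal \<epsilon> + ereal (2 * \<epsilon>)"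
      by (intro add_mono)
    then show ?thesis by simp
  qed
  have "\<delta>\<^sub>0 > 0"
    using c by (simp add: \<delta>\<^sub>0_def)
  then show ?thesis
    by (rule exI[of _ \<delta>\<^sub>0, OF conjI], intro exI[of _ 7] conjI allI impI; (elim conjE)?)
      (simp, rule main)
qed

end
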